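(* For any positive integer $m$, as formal power series, \[ \sum_{\alpha\in \mathrm{CS}^{\le m}} (q^\nu z^2)^{\mathrm{col}(\alpha)} (q^\nu)^{\mathrm{row}(\alpha)} q^{\mathrm{area}(\alpha)}= -q^\nu z \frac{R_{m,\nu+2}(z;q^{-1})}{R_{m+1,\nu+1}(z;q^{-1})}, \] where the right-hand side is expanded as a power series in $z$.
   Context: A partition is a weakly decreasing finite sequence of positive integers; its Young diagram is the left-justified array of squares with $\sigma_i$ squares in row $i$. For partitions $\rho\subseteq\sigma$ the skew shape $\sigma/\rho$ is the set difference of their Young diagrams; skew shapes differing by a translation are identified. A skew shape is connected if any two of its squares are joined by a sequence of squares in it with consecutive squares sharing an edge. For a nonempty connected skew shape $\alpha$, $\mathrm{col}(\alpha)$, $\mathrm{row}(\alpha)$, $\mathrm{area}(\alpha)$ are its numbers of nonempty columns, nonempty rows and squares. A diagonal of $\alpha$ is the set of its squares in row $i$, column $j$ with $i-j=k$ for a fixed integer $k$. $\mathrm{CS}^{\le m}$ is the set of nonempty connected skew shapes in which every diagonal has at most $m$ squares. The $q$-Lommel polynomials with base $p$ are Laurent polynomials in $z$ defined by $R_{-1,\nu}(z;p)=0$, $R_{0,\nu}(z;p)=1$, and $R_{m+1,\nu}(z;p)=(z+z^{-1}(1-p^{\nu+m}))R_{m,\nu}(z;p)-R_{m-1,\nu}(z;p)$ for $m\ge0$; here $p=q^{-1}$.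
   Formalization: The printed right-hand side is off by one (for m=1 it also counts the 2×2 square, which is not in CS^{≤1}); the formal theorem proves the sum over CS^{≤m} equals -q^ν z R_{m-1,ν+2}/R_{m,ν+1} for all m≥1. *)

theory Defs
  imports "HOL-Computational_Algebra.Computational_Algebra"
begin

unbundle fps_syntax

section \<open>Skew shapes\<close>

text \<open>
  Squares are pairs (row, column), both counted from 0; translations make the choice of
  origin irrelevant, and for diagonals only the difference of the two matters.
\<close>

type_synonym shape = "(nat \<times> nat) set"

definition is_partition :: "nat list \<Rightarrow> bool" where
  "is_partition \<sigma> \<longleftrightarrow> sorted_wrt (\<ge>) \<sigma> \<and> (\<forall>x\<in>set \<sigma>. 0 < x)"

definition young_diagram :: "nat list \<Rightarrow> shape" where
  "young_diagram \<sigma> = {(i, j). i < length \<sigma> \<and> j < \<sigma> ! i}"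

definition skew_shape :: "shape \<Rightarrow> bool" where
  "skew_shape A \<longleftrightarrow> (\<exists>\<sigma> \<rho>. is_partition \<sigma> \<and> is_partition \<rho> \<and>
     young_diagram \<rho> \<subseteq> young_diagram \<sigma> \<and> A = young_diagram \<sigma> - young_diagram \<rho>)"

definition share_edge :: "nat \<times> nat \<Rightarrow> nat \<times> nat \<Rightarrow> bool" where
  "share_edge s t \<longleftrightarrow>
     fst s = fst t \<and> (snd s = Suc (snd t) \<or> snd t = Suc (snd s)) \<or>
     snd s = snd t \<and> (fst s = Suc (fst t) \<or> fst t = Suc (fst s))"

definition connected_shape :: "shape \<Rightarrow> bool" where
  "connected_shape A \<longleftrightarrow>
     (\<forall>s\<in>A. \<forall>t\<in>A. (s, t) \<in> {(u, v). u \<in> A \<and> v \<in> A \<and> share_edge u v}\<^sup>*)"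

definition diagonal :: "shape \<Rightarrow> int \<Rightarrow> shape" where
  "diagonal A k = {(i, j) \<in> A. int i - int j = k}"

definition col_shape :: "shape \<Rightarrow> nat" where "col_shape A = card (snd ` A)"
definition row_shape :: "shape \<Rightarrow> nat" where "row_shape A = card (fst ` A)"
definition area_shape :: "shape \<Rightarrow> nat" where "area_shape A = card A"

definition translate_of :: "shape \<Rightarrow> shape \<Rightarrow> bool" where
  "translate_of A B \<longleftrightarrow>
     (\<exists>a b :: int. (\<lambda>(i, j). (int i + a, int j + b)) ` A = map_prod int int ` B)"

text \<open>Skew shapes up to translation are the equivalence classes of this relation.\<close>

definition translation :: "(shape \<times> shape) set" where
  "translation = {(A, B). skew_shape A \<and> skew_shape B \<and> translate_of A B}"

definition CS_le :: "nat \<Rightarrow> shape set set" where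
  "CS_le m = {A. skew_shape A \<and> A \<noteq> {} \<and> connected_shape A \<and>
     (\<forall>k. card (diagonal A k) \<le> m)} // translation"

definition rep :: "shape set \<Rightarrow> shape" where "rep \<alpha> = (SOME A. A \<in> \<alpha>)"

definition col :: "shape set \<Rightarrow> nat" where "col \<alpha> = col_shape (rep \<alpha>)"
definition row :: "shape set \<Rightarrow> nat" where "row \<alpha> = row_shape (rep \<alpha>)"
definition area :: "shape set \<Rightarrow> nat" where "area \<alpha> = area_shape (rep \<alpha>)"

lemma translate_of_refl: "translate_of A A"
  unfolding translate_of_def
  by (intro exI[of _ "0::int"]) (auto simp: map_prod_def intro!: image_cong)

lemma translate_of_sym:
  assumes "translate_of A B"
  shows "translate_of B A"
proof -
  obtain a b :: int where
    ab: "(\<lambda>(i, j). (int i + a, int j + b)) ` A = map_prod int int ` B"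
    using assms unfolding translate_of_def by blast
  have "(\<lambda>(i, j). (int i + (-a), int j + (-b))) ` B
      = (\<lambda>(i, j). (i - a, j - b)) ` (map_prod int int ` B)"
    by (simp add: image_image case_prod_unfold)
  also have "\<dots> = map_prod int int ` A"
    unfolding ab[symmetric] by (simp add: image_image case_prod_unfold map_prod_def)
  finally show ?thesis unfolding translate_of_def by blast
qed

lemma translate_of_trans:
  assumes "translate_of A B" "translate_of B C"
  shows "translate_of A C"
proof -
  obtain a b :: int where
    ab: "(\<lambda>(i, j). (int i + a, int j + b)) ` A = map_prod int int ` B"
    using assms(1) unfolding translate_of_def by blast
  obtain c d :: int where
    cd: "(\<lambda>(i, j). (int i + c, int j + d)) ` B = map_prod int int ` C"
    using assms(2) unfolding translate_of_def by blast
  have "(\<lambda>(i, j). (int i + (a + c), int j + (b + d))) ` A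
      = (\<lambda>(i, j). (i + c, j + d)) ` ((\<lambda>(i, j). (int i + a, int j + b)) ` A)"
    by (simp add: image_image case_prod_unfold add.assoc)
  also have "\<dots> = map_prod int int ` C"
    unfolding ab cd[symmetric] by (simp add: image_image case_prod_unfold)
  finally show ?thesis unfolding translate_of_def by blast
qed

lemma equiv_translation: "equiv {A. skew_shape A} translation"
  unfolding translation_def equiv_def refl_on_def sym_def trans_def
  by (auto intro: translate_of_refl translate_of_sym translate_of_trans)

lemma translate_of_stats:
  assumes "translate_of A B"
  shows "col_shape A = col_shape B" "row_shape A = row_shape B" "area_shape A = area_shape B"
proof -
  obtain a b :: int where
    ab: "(\<lambda>(i, j). (int i + a, int j + b)) ` A = map_prod int int ` B"
    using assms unfolding translate_of_def by blast
  have "(\<lambda>j. int j + b) ` snd ` A = int ` snd ` B"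
    using arg_cong[OF ab, of "image snd"] by (simp add: image_image case_prod_unfold)
  moreover have "card ((\<lambda>j. int j + b) ` snd ` A) = card (snd ` A)"
    by (intro card_image) (auto simp: inj_on_def)
  moreover have "card (int ` snd ` B) = card (snd ` B)"
    by (intro card_image) (auto simp: inj_on_def)
  ultimately show "col_shape A = col_shape B" by (simp add: col_shape_def)
  have "(\<lambda>i. int i + a) ` fst ` A = int ` fst ` B"
    using arg_cong[OF ab, of "image fst"] by (simp add: image_image case_prod_unfold)
  moreover have "card ((\<lambda>i. int i + a) ` fst ` A) = card (fst ` A)"
    by (intro card_image) (auto simp: inj_on_def)
  moreover have "card (int ` fst ` B) = card (fst ` B)"
    by (intro card_image) (auto simp: inj_on_def)
  ultimately show "row_shape A = row_shape B" by (simp add: row_shape_def)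
  have "card ((\<lambda>(i, j). (int i + a, int j + b)) ` A) = card A"
    by (intro card_image) (auto simp: inj_on_def)
  moreover have "card (map_prod int int ` B) = card B"
    by (intro card_image) (auto simp: inj_on_def)
  ultimately show "area_shape A = area_shape B" by (simp add: area_shape_def ab)
qed

lemma rep_CS_le:
  assumes "\<alpha> \<in> CS_le m"
  obtains A where "skew_shape A" "A \<noteq> {}" "connected_shape A" "\<And>k. card (diagonal A k) \<le> m"
    "\<alpha> = translation `` {A}" "(A, rep \<alpha>) \<in> translation"
proof -
  obtain A where A: "skew_shape A" "A \<noteq> {}" "connected_shape A"
    "\<And>k. card (diagonal A k) \<le> m" "\<alpha> = translation `` {A}"
    using assms unfolding CS_le_def by (auto elim!: quotientE)
  have "A \<in> \<alpha>"
    using A(1,5) by (auto simp: translation_def translate_of_refl)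
  then have "rep \<alpha> \<in> \<alpha>" unfolding rep_def by (rule someI)
  then show thesis using A that by auto
qed

lemma stats_class:
  assumes "\<alpha> \<in> CS_le m" "A \<in> \<alpha>"
  shows "col \<alpha> = col_shape A" "row \<alpha> = row_shape A" "area \<alpha> = area_shape A"
proof -
  obtain B where "\<alpha> = translation `` {B}" "(B, rep \<alpha>) \<in> translation"
    using assms(1) by (elim rep_CS_le)
  then have "translate_of B A" "translate_of B (rep \<alpha>)"
    using assms(2) by (auto simp: translation_def)
  then have "translate_of (rep \<alpha>) A"
    by (blast intro: translate_of_sym translate_of_trans)
  then show "col \<alpha> = col_shape A" "row \<alpha> = row_shape A" "area \<alpha> = area_shape A"
    by (simp_all add: col_def row_def area_def translate_of_stats)
qed


section \<open>Formal power series\<close>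

text \<open>
  Power series with integer coefficients in the independent indeterminates z (outermost),
  q to the power nu (a single indeterminate, since nu is formal) and q (innermost).
\<close>

type_synonym series3 = "int fps fps fps"

definition zv :: series3 where "zv = fps_X"
definition qnu :: series3 where "qnu = fps_const fps_X"
definition qv :: series3 where "qv = fps_const (fps_const fps_X)"

text \<open>
  The sum of an infinite family in which each monomial has a nonzero coefficient in only
  finitely many members; a monomial violating this would silently get coefficient 0.
  For the weights below, this never happens (lemma \<open>finite_CS_weight\<close>).
\<close>

definition formal_sum :: "('b \<Rightarrow> series3) \<Rightarrow> 'b set \<Rightarrow> series3" where
  "formal_sum f S = Abs_fps (\<lambda>i. Abs_fps (\<lambda>j. Abs_fps (\<lambda>k.
     \<Sum>s | s \<in> S \<and> f s $ i $ j $ k \<noteq> 0. f s $ i $ j $ k)))"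

definition CS_weight :: "shape set \<Rightarrow> series3" where
  "CS_weight \<alpha> = (qnu * zv ^ 2) ^ col \<alpha> * qnu ^ row \<alpha> * qv ^ area \<alpha>"

lemma CS_weight_nth:
  "CS_weight \<alpha> $ i $ j $ k =
     (if i = 2 * col \<alpha> \<and> j = col \<alpha> + row \<alpha> \<and> k = area \<alpha> then 1 else 0)"
proof -
  have "CS_weight \<alpha> = fps_const (fps_const (fps_X ^ area \<alpha>) * fps_X ^ (col \<alpha> + row \<alpha>))
      * fps_X ^ (2 * col \<alpha>)"
    by (simp add: CS_weight_def zv_def qnu_def qv_def power_mult_distrib power_add
        fps_const_power flip: power_mult fps_const_mult)
  then show ?thesis
    by (auto simp: fps_X_power_mult_right_nth fps_mult_left_const_nth)
qed

lemma connected_shape_rows: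
  assumes "connected_shape A" "s \<in> A" "t \<in> A" "fst s \<le> r" "r \<le> fst t"
  shows "r \<in> fst ` A"
proof -
  have "(s, t) \<in> {(u, v). u \<in> A \<and> v \<in> A \<and> share_edge u v}\<^sup>*"
    using assms unfolding connected_shape_def by blast
  then show ?thesis using assms(2,4,5)
  proof (induction arbitrary: r rule: rtrancl_induct)
    case base
    then show ?case by (metis image_eqI le_antisym)
  next
    case (step y z)
    show ?case
    proof (cases "r \<le> fst y")
      case True
      then show ?thesis using step by blast
    next
      case False
      then have "r = fst z" using step.hyps(2) step.prems by (auto simp: share_edge_def)
      then show ?thesis using step.hyps(2) by auto
    qed
  qed
qed

lemma connected_shape_cols:
  assumes "connected_shape A" "s \<in> A" "t \<in> A" "snd s \<le> r" "r \<le> snd t"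
  shows "r \<in> snd ` A"
proof -
  have "(s, t) \<in> {(u, v). u \<in> A \<and> v \<in> A \<and> share_edge u v}\<^sup>*"
    using assms unfolding connected_shape_def by blast
  then show ?thesis using assms(2,4,5)
  proof (induction arbitrary: r rule: rtrancl_induct)
    case base
    then show ?case by (metis image_eqI le_antisym)
  next
    case (step y z)
    show ?case
    proof (cases "r \<le> snd y")
      case True
      then show ?thesis using step by blast
    next
      case False
      then have "r = snd z" using step.hyps(2) step.prems by (auto simp: share_edge_def)
      then show ?thesis using step.hyps(2) by auto
    qed
  qed
qed

lemma finite_young_diagram: "finite (young_diagram \<sigma>)"
proof (rule finite_subset)
  show "young_diagram \<sigma> \<subseteq> (SIGMA i:{..<length \<sigma>}. {..<\<sigma> ! i})"
    by (auto simp: young_diagram_def)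
qed auto

lemma finite_skew_shape: "skew_shape A \<Longrightarrow> finite A"
  by (auto simp: skew_shape_def finite_young_diagram)

lemma finite_CS_le_area: "finite {\<alpha> \<in> CS_le m. area \<alpha> = n}"
proof -
  define norm :: "shape \<Rightarrow> shape" where
    "norm A = (\<lambda>(i, j). (i - Min (fst ` A), j - Min (snd ` A))) ` A" for A
  define pick where "pick \<alpha> = (SOME A. skew_shape A \<and> A \<noteq> {} \<and> connected_shape A \<and>
      \<alpha> = translation `` {A} \<and> (A, rep \<alpha>) \<in> translation)" for \<alpha>
  have pick: "skew_shape (pick \<alpha>)" "pick \<alpha> \<noteq> {}" "connected_shape (pick \<alpha>)"
      "\<alpha> = translation `` {pick \<alpha>}" "(pick \<alpha>, rep \<alpha>) \<in> translation"
    if "\<alpha> \<in> CS_le m" for \<alpha>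
  proof -
    have "\<exists>A. skew_shape A \<and> A \<noteq> {} \<and> connected_shape A \<and>
      \<alpha> = translation `` {A} \<and> (A, rep \<alpha>) \<in> translation"
      using that by (elim rep_CS_le) blast
    from someI_ex[OF this] show "skew_shape (pick \<alpha>)" "pick \<alpha> \<noteq> {}" "connected_shape (pick \<alpha>)"
      "\<alpha> = translation `` {pick \<alpha>}" "(pick \<alpha>, rep \<alpha>) \<in> translation"
      unfolding pick_def[symmetric] by blast+
  qed
  have norm_int: "(\<lambda>(i, j). (int i + - int (Min (fst ` A)), int j + - int (Min (snd ` A)))) ` A
      = map_prod int int ` norm A" if "finite A" for A
  proof -
    have "int (i - Min (fst ` A)) = int i + - int (Min (fst ` A))"
         "int (j - Min (snd ` A)) = int j + - int (Min (snd ` A))" if "(i, j) \<in> A" for i j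
    proof -
      have "Min (fst ` A) \<le> i" "Min (snd ` A) \<le> j"
        using \<open>finite A\<close> that by (force intro!: Min_le)+
      then show "int (i - Min (fst ` A)) = int i + - int (Min (fst ` A))"
         "int (j - Min (snd ` A)) = int j + - int (Min (snd ` A))" by (simp_all add: of_nat_diff)
    qed
    then show ?thesis unfolding norm_def image_image
      by (intro image_cong) (auto simp: case_prod_unfold)
  qed
  have trans_norm: "translate_of A (norm A)" if "finite A" for A
    using norm_int[OF that] unfolding translate_of_def by blast
  have inj: "inj_on (\<lambda>\<alpha>. norm (pick \<alpha>)) {\<alpha> \<in> CS_le m. area \<alpha> = n}"
  proof (rule inj_onI)
    fix \<alpha> \<beta>
    assume \<alpha>: "\<alpha> \<in> {\<alpha> \<in> CS_le m. area \<alpha> = n}" and \<beta>: "\<beta> \<in> {\<alpha> \<in> CS_le m. area \<alpha> = n}"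
      and eq: "norm (pick \<alpha>) = norm (pick \<beta>)"
    have sk: "skew_shape (pick \<alpha>)" "skew_shape (pick \<beta>)"
      using \<alpha> \<beta> pick(1) by simp_all
    have "translate_of (pick \<alpha>) (norm (pick \<beta>))"
      unfolding eq[symmetric] by (intro trans_norm finite_skew_shape sk)
    moreover have "translate_of (norm (pick \<beta>)) (pick \<beta>)"
      by (intro translate_of_sym[OF trans_norm] finite_skew_shape sk)
    ultimately have "(pick \<alpha>, pick \<beta>) \<in> translation"
      using sk translate_of_trans unfolding translation_def by simp
    then have "translation `` {pick \<alpha>} = translation `` {pick \<beta>}"
      by (rule equiv_class_eq[OF equiv_translation])
    moreover have "\<alpha> = translation `` {pick \<alpha>}" "\<beta> = translation `` {pick \<beta>}"
      using \<alpha> \<beta> by (simp_all flip: pick(4))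
    ultimately show "\<alpha> = \<beta>" by simp
  qed
  have box: "norm (pick \<alpha>) \<subseteq> {..n} \<times> {..n}" if "\<alpha> \<in> CS_le m" "area \<alpha> = n" for \<alpha>
  proof -
    let ?A = "pick \<alpha>"
    note p = pick[OF that(1)]
    have fin: "finite ?A" using p(1) by (rule finite_skew_shape)
    have "pick \<alpha> \<in> translation `` {pick \<alpha>}" using p(1) by (auto simp: translation_def translate_of_refl)
    then have "pick \<alpha> \<in> \<alpha>" by (simp flip: p(4))
    then have n: "card ?A = n" using stats_class(3)[OF that(1)] that(2) by (simp add: area_shape_def)
    have "i - Min (fst ` ?A) \<le> n" "j - Min (snd ` ?A) \<le> n" if ij: "(i, j) \<in> ?A" for i j
    proof -
      have "Min (fst ` ?A) \<in> fst ` ?A" "Min (snd ` ?A) \<in> snd ` ?A"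
        using fin p(2) by (auto intro!: Min_in)
      then have "{Min (fst ` ?A)..i} \<subseteq> fst ` ?A" "{Min (snd ` ?A)..j} \<subseteq> snd ` ?A"
        using connected_shape_rows[OF p(3) _ ij] connected_shape_cols[OF p(3) _ ij]
        by (auto simp only: imageE atLeastAtMost_iff subset_iff fst_conv snd_conv)
      then have "card {Min (fst ` ?A)..i} \<le> n" "card {Min (snd ` ?A)..j} \<le> n"
        using fin n by (meson card_image_le card_mono finite_imageI le_trans)+
      then show "i - Min (fst ` ?A) \<le> n" "j - Min (snd ` ?A) \<le> n" by auto
    qed
    then show ?thesis unfolding norm_def by auto
  qed
  show ?thesis
  proof (rule finite_imageD[OF _ inj])
    show "finite ((\<lambda>\<alpha>. norm (pick \<alpha>)) ` {\<alpha> \<in> CS_le m. area \<alpha> = n})"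
      by (rule finite_subset[of _ "Pow ({..n} \<times> {..n})"]) (use box in auto)
  qed
qed

lemma finite_CS_weight: "finite {\<alpha>. \<alpha> \<in> CS_le m \<and> CS_weight \<alpha> $ i $ j $ k \<noteq> 0}"
  by (rule finite_subset[OF _ finite_CS_le_area[of m k]]) (auto simp: CS_weight_nth)

text \<open>
  The right-hand side involves negative powers of q and of q to the power nu. It lives in
  the field of Laurent series in z over the fraction field of the power series in
  q to the power nu and q, where dividing is expanding in powers of z.
\<close>

definition emb :: "series3 \<Rightarrow> int fps fps fract fls" where
  "emb F = fps_to_fls (Abs_fps (\<lambda>n. Fract (F $ n) 1))"


section \<open>The q-Lommel polynomials\<close>

text \<open>
  The third argument P is p to the power nu. The second equation is the
  recurrence for m = 0 with the convention that the polynomial of index -1 is 0.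
\<close>

fun lommel :: "nat \<Rightarrow> 'a::field \<Rightarrow> 'a \<Rightarrow> 'a \<Rightarrow> 'a" where
  "lommel 0 z P p = 1"
| "lommel (Suc 0) z P p = (z + inverse z * (1 - P)) * 1 - 0"
| "lommel (Suc (Suc m)) z P p =
     (z + inverse z * (1 - P * p ^ Suc m)) * lommel (Suc m) z P p - lommel m z P p"

text \<open>
  The polynomial of index m and order nu + s, with base the inverse of q.

  The shapes with at most m squares on each diagonal belong to the quotient of the
  polynomials of index m - 1 and m, not m and m + 1: \<open>CS_le 1\<close> is the set of ribbons, whose
  generating function is b x y / (1 - b (1 + y)) with x the power q to the nu, b = q x and
  y the square of z. This is the quotient for the indices 0 and 1. The quotient for
  1 and 2 has the additional term y^2 x^4 q^4 of the two-by-two square.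
\<close>

definition R :: "nat \<Rightarrow> nat \<Rightarrow> int fps fps fract fls" where
  "R m s = lommel m (emb zv) (inverse (emb qnu * emb qv ^ s)) (inverse (emb qv))"

end

theory Submission
  imports Defs
begin

text \<open>
  Cut a connected skew shape along its diagonals, from the lower left to the upper right. The
  rows met by a diagonal form an interval, and each end of the interval stays or moves up by one
  row from one diagonal to the next. This encodes the shape as a walk whose heights are the sizes
  of the diagonals: it starts and ends at height 1, has heights between 1 and m, and its four
  kinds of steps (does the upper end move, does the lower end move) carry the numbers of rows and columns,
  while the area is the sum of the heights. Splitting off the first step gives a
  tridiagonal linear system for the generating functions of the walks from height k to height 1.
  Up to powers of -z, it is the recurrence of the q-Lommel polynomials in which m decreases and
  the order increases.
\<close>

section \<open>The recurrence in the order\<close>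

text \<open>The polynomial is a continuant: the determinant of a tridiagonal matrix with diagonal
  entries \<open>z + inverse z * (1 - P * p ^ i)\<close>. The definition expands along the last
  entry. Expanding along the first one lowers the index while raising the order.\<close>

lemma lommel_Suc_Suc_shift:
  fixes z :: "'a::field"
  shows "lommel (Suc (Suc n)) z P p =
    (z + inverse z * (1 - P)) * lommel (Suc n) z (P * p) p - lommel n z (P * p ^ 2) p"
proof (induction n z P p rule: lommel.induct)
  case (3 n z P p)
  \<comment> \<open>\<open>a\<close> is the last coefficient for all three orders, since
    \<open>P * p ^ (n + 3)\<close>, \<open>(P * p) * p ^ (n + 2)\<close> and
    \<open>(P * p ^ 2) * p ^ (n + 1)\<close> coincide. Hence the two expansions commute.\<close>
  define a where "a = z + inverse z * (1 - P * p ^ Suc (Suc (Suc n)))"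
  define b where "b = z + inverse z * (1 - P)"
  have "lommel (Suc (Suc (Suc (Suc n)))) z P p =
      a * lommel (Suc (Suc (Suc n))) z P p - lommel (Suc (Suc n)) z P p"
    by (simp only: lommel.simps a_def)
  also have "\<dots> = a * (b * lommel (Suc (Suc n)) z (P * p) p - lommel (Suc n) z (P * p ^ 2) p)
      - (b * lommel (Suc n) z (P * p) p - lommel n z (P * p ^ 2) p)"
    by (simp only: 3 b_def)
  also have "\<dots> = b * (a * lommel (Suc (Suc n)) z (P * p) p - lommel (Suc n) z (P * p) p)
      - (a * lommel (Suc n) z (P * p ^ 2) p - lommel n z (P * p ^ 2) p)"
    by (simp only: algebra_simps)
  also have "a * lommel (Suc (Suc n)) z (P * p) p - lommel (Suc n) z (P * p) p
      = lommel (Suc (Suc (Suc n))) z (P * p) p"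
    by (simp add: a_def power2_eq_square mult.assoc)
  also have "a * lommel (Suc n) z (P * p ^ 2) p - lommel n z (P * p ^ 2) p
      = lommel (Suc (Suc n)) z (P * p ^ 2) p"
    by (simp add: a_def power2_eq_square mult.assoc)
  finally show ?case by (simp only: b_def)
qed (simp_all add: algebra_simps power2_eq_square)

text \<open>Under \<open>G k = (- z) ^ k * D (Suc k) * T\<close> the homogeneous equations become
  the recurrence of \<open>D\<close>, and \<open>G (Suc m) = 0\<close> becomes
  \<open>D (Suc (Suc m)) = 0\<close>. The inhomogeneous equation at \<open>k = 1\<close> fixes
  \<open>T\<close>.\<close>

lemma tridiagonal_system_first:
  fixes G D c :: "nat \<Rightarrow> 'a::field"
  assumes "z \<noteq> 0" "x \<noteq> 0" "1 \<le> m"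
    and D: "\<And>k. \<lbrakk>1 \<le> k; k \<le> m\<rbrakk> \<Longrightarrow> D k = c k * D (Suc k) - D (Suc (Suc k))"
    and D_end: "D (Suc m) = 1" "D (Suc (Suc m)) = 0"
    and G: "\<And>k. \<lbrakk>1 \<le> k; k \<le> m\<rbrakk> \<Longrightarrow> - c k * G k =
      inverse z * G (Suc k) + z * G (k - 1) + (if k = 1 then inverse (x * z) else 0)"
    and G_end: "G 0 = 0" "G (Suc m) = 0"
  shows "x * (x * z ^ 2) * G 1 = - x * z * (D 2 / D 1)"
proof -
  \<comment> \<open>Forced by the ansatz at \<open>k = m\<close>, where
    \<open>D (Suc m) = 1\<close>.\<close>
  define T where "T = G m / (- z) ^ m"
  have D_step: "inverse z * G (Suc k) + c k * G k = (- z) ^ k * D k * T"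
    if "G k = (- z) ^ k * D (Suc k) * T" "G (Suc k) = (- z) ^ Suc k * D (Suc (Suc k)) * T"
      "1 \<le> k" "k \<le> m" for k
    unfolding that(1,2) D[OF that(3,4)] using \<open>z \<noteq> 0\<close> by (simp add: field_simps)
  \<comment> \<open>Downward induction from \<open>m\<close>, carrying two neighbouring values
    because the recurrence has second order.\<close>
  have GD: "G k = (- z) ^ k * D (Suc k) * T \<and> G (Suc k) = (- z) ^ Suc k * D (Suc (Suc k)) * T"
    if "1 \<le> k" "k \<le> m" for k
    using that(2)
  proof (induction k rule: inc_induct)
    case base
    then show ?case using D_end G_end \<open>z \<noteq> 0\<close> by (simp add: T_def)
  next
    case (step j)
    then have IH: "G (Suc j) = (- z) ^ Suc j * D (Suc (Suc j)) * T"
      "G (Suc (Suc j)) = (- z) ^ Suc (Suc j) * D (Suc (Suc (Suc j))) * T" by simp_all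
    have A: "inverse z * G (Suc (Suc j)) + c (Suc j) * G (Suc j) = (- z) ^ Suc j * D (Suc j) * T"
      using step.hyps by (intro D_step IH) auto
    have "z * G j = - c (Suc j) * G (Suc j) - inverse z * G (Suc (Suc j))"
      using G[of "Suc j"] step.hyps \<open>1 \<le> k\<close> by simp
    also have "\<dots> = - (inverse z * G (Suc (Suc j)) + c (Suc j) * G (Suc j))"
      by simp
    also have "\<dots> = z * ((- z) ^ j * D (Suc j) * T)"
      unfolding A by simp
    finally have "G j = (- z) ^ j * D (Suc j) * T"
      using \<open>z \<noteq> 0\<close> by simp
    with IH show ?case by simp
  qed
  have A: "inverse z * G 2 + c 1 * G 1 = - z * D 1 * T"
    using D_step[of 1] GD[of 1] \<open>1 \<le> m\<close> by (simp add: numeral_2_eq_2)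
  \<comment> \<open>As \<open>G 0 = 0\<close>, the inhomogeneous term takes the place of
    \<open>z * G 0\<close>.\<close>
  have "inverse (x * z) = - c 1 * G 1 - inverse z * G 2"
    using G[of 1] G_end \<open>1 \<le> m\<close> by (simp add: numeral_2_eq_2)
  also have "\<dots> = - (inverse z * G 2 + c 1 * G 1)"
    by simp
  also have "\<dots> = z * D 1 * T"
    unfolding A by simp
  finally have "z * D 1 * T = inverse (x * z)" ..
  then have DT: "x * z ^ 2 * D 1 * T = 1"
    using assms(1,2) by (simp add: field_simps power2_eq_square)
  \<comment> \<open>Solvability of the system makes the denominator nonzero.\<close>
  then have "D 1 \<noteq> 0" by auto
  have "x * (x * z ^ 2) * G 1 * D 1 = - x * z * D 2 * (x * z ^ 2 * D 1 * T)"
    using GD[of 1] \<open>1 \<le> m\<close> by (simp add: numeral_2_eq_2)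
  also have "\<dots> = - x * z * D 2"
    unfolding DT by simp
  finally have "x * (x * z ^ 2) * G 1 = - x * z * D 2 / D 1"
    by (rule nonzero_eq_divide_eq[OF \<open>D 1 \<noteq> 0\<close>, THEN iffD2])
  then show ?thesis by simp
qed

section \<open>The embedding of the power series\<close>

lemma Fract_add_1: "Fract (a + b) 1 = Fract a 1 + Fract b 1"
  by simp

lemma emb_add: "emb (F + G) = emb F + emb G"
proof -
  have "Abs_fps (\<lambda>n. Fract ((F + G) $ n) 1) = Abs_fps (\<lambda>n. Fract (F $ n) 1) + Abs_fps (\<lambda>n. Fract (G $ n) 1)"
    by (simp add: fps_eq_iff)
  then show ?thesis by (simp add: emb_def)
qed

lemma emb_mult: "emb (F * G) = emb F * emb G"
proof -
  have Fract_sum: "Fract (sum f I) 1 = (\<Sum>i\<in>I. Fract (f i) 1)"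
    for f :: "nat \<Rightarrow> int fps fps" and I
    by (induction I rule: infinite_finite_induct) (simp_all add: fract_collapse Fract_add_1 del: add_fract)
  show ?thesis
    by (simp add: emb_def fps_eq_iff fps_mult_nth Fract_sum flip: fls_times_fps_to_fls)
qed

lemma emb_0: "emb 0 = 0"
  by (simp add: emb_def fract_collapse flip: fps_zero_def)

lemma emb_1: "emb 1 = 1"
proof -
  have "Abs_fps (\<lambda>n. Fract ((1 :: series3) $ n) 1) = 1"
    by (simp add: fps_eq_iff fract_collapse)
  then show ?thesis by (simp add: emb_def)
qed

lemma emb_power: "emb (F ^ n) = emb F ^ n"
  by (induction n) (simp_all add: emb_1 emb_mult)

text \<open>Injectivity makes the embedded indeterminates invertible in the field.\<close>

lemma emb_eq_0_iff: "emb F = 0 \<longleftrightarrow> F = 0"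
proof -
  have "Fract a 1 = 0 \<longleftrightarrow> a = 0" for a :: "int fps fps"
    by (simp add: Zero_fract_def eq_fract)
  then have "emb F = 0 \<longleftrightarrow> (\<forall>n. F $ n = 0)"
    unfolding emb_def fps_to_fls_eq_0_iff by (subst fps_eq_iff) simp
  also have "\<dots> \<longleftrightarrow> F = 0"
    by (subst fps_eq_iff) simp
  finally show ?thesis .
qed

section \<open>Walks and their generating functions\<close>

text \<open>The first component tells whether the upper end of the diagonal moves up, which gains a
  square; the second does so for the lower end, which loses one. The subtraction is exact for
  \<open>1 <= k\<close>.\<close>

definition next_height :: "nat \<Rightarrow> bool \<times> bool \<Rightarrow> nat" where
  "next_height k s = k + of_bool (fst s) - of_bool (snd s)"

fun walk :: "nat \<Rightarrow> nat \<Rightarrow> (bool \<times> bool) list \<Rightarrow> bool" where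
  "walk m k [] \<longleftrightarrow> k = 1 \<and> k \<le> m"
| "walk m k (s # w) \<longleftrightarrow> 1 \<le> k \<and> k \<le> m \<and> walk m (next_height k s) w"

fun walk_area :: "nat \<Rightarrow> (bool \<times> bool) list \<Rightarrow> nat" where
  "walk_area k [] = k"
| "walk_area k (s # w) = k + walk_area (next_height k s) w"

text \<open>If the upper end moves up, the top square of the next diagonal opens a new row;
  otherwise it opens a new column. Every step thus accounts for exactly one of the two.\<close>

definition step_weight :: "bool \<times> bool \<Rightarrow> series3" where
  "step_weight s = (if fst s then qnu else qnu * zv ^ 2)"

fun walk_weight :: "nat \<Rightarrow> (bool \<times> bool) list \<Rightarrow> series3" where
  "walk_weight k [] = qv ^ k"
| "walk_weight k (s # w) = qv ^ k * (step_weight s * walk_weight (next_height k s) w)"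

definition walk_gf :: "nat \<Rightarrow> nat \<Rightarrow> series3" where
  "walk_gf m k = formal_sum (walk_weight k) {w. walk m k w}"

lemma walk_height: "walk m k w \<Longrightarrow> 1 \<le> k \<and> k \<le> m"
  by (cases w) auto

text \<open>All heights are at least 1, and there is one more height than steps. So only finitely
  many walks contribute to a given power of q.\<close>

lemma length_less_walk_area: "walk m k w \<Longrightarrow> length w < walk_area k w"
proof (induction w arbitrary: k)
  case (Cons s w)
  then show ?case by fastforce
qed auto

lemma monomial_nth:
  "((qnu * zv ^ 2) ^ c * qnu ^ r * qv ^ a) $ i $ j $ k =
     (if i = 2 * c \<and> j = c + r \<and> k = a then 1 else 0)"
proof -
  have "(qnu * zv ^ 2) ^ c * qnu ^ r * qv ^ a =
      fps_const (fps_const (fps_X ^ a) * fps_X ^ (c + r)) * fps_X ^ (2 * c)"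
    by (simp add: zv_def qnu_def qv_def power_mult_distrib power_add
        fps_const_power flip: power_mult fps_const_mult)
  then show ?thesis
    by (auto simp: fps_X_power_mult_right_nth fps_mult_left_const_nth)
qed

lemma walk_weight_monomial:
  "walk_weight k w = (qnu * zv ^ 2) ^ length (filter (Not \<circ> fst) w) *
     qnu ^ length (filter fst w) * qv ^ walk_area k w"
  by (induction w arbitrary: k) (simp_all add: step_weight_def power_add)

lemma walk_weight_nth_eq_0:
  "\<lbrakk>walk m k w; a \<le> length w\<rbrakk> \<Longrightarrow> walk_weight k w $ i $ j $ a = 0"
  using length_less_walk_area[of m k w] by (simp add: walk_weight_monomial monomial_nth)

text \<open>A coefficient can be read off any finite partial sum that contains all contributing
  members.\<close>

lemma formal_sum_nth:
  assumes "finite T" "T \<subseteq> S" "\<And>s. \<lbrakk>s \<in> S; s \<notin> T\<rbrakk> \<Longrightarrow> f s $ i $ j $ k = 0"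
  shows "formal_sum f S $ i $ j $ k = (\<Sum>s\<in>T. f s) $ i $ j $ k"
proof -
  have "(\<Sum>s | s \<in> S \<and> f s $ i $ j $ k \<noteq> 0. f s $ i $ j $ k) = (\<Sum>s\<in>T. f s $ i $ j $ k)"
    using assms by (intro sum.mono_neutral_left) auto
  then show ?thesis by (simp add: formal_sum_def fps_sum_nth)
qed

text \<open>For each monomial, \<open>h\<close> matches the contributing members, so the sums agree
  even where an infinite set yields the default 0.\<close>

lemma formal_sum_reindex:
  assumes "bij_betw h S' S" "\<And>s. s \<in> S' \<Longrightarrow> f (h s) = g s"
  shows "formal_sum f S = formal_sum g S'"
proof -
  have "(\<Sum>s | s \<in> S \<and> f s $ i $ j $ k \<noteq> 0. f s $ i $ j $ k) =
      (\<Sum>s | s \<in> S' \<and> g s $ i $ j $ k \<noteq> 0. g s $ i $ j $ k)" for i j k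
  proof (rule sum.reindex_bij_betw[symmetric, of h, THEN trans])
    show "bij_betw h {s. s \<in> S' \<and> g s $ i $ j $ k \<noteq> 0} {s. s \<in> S \<and> f s $ i $ j $ k \<noteq> 0}"
      by (rule bij_betw_subset[OF assms(1)])
        (use assms in \<open>auto simp: bij_betw_def image_iff\<close>)
  qed (use assms(2) in simp)
  then show ?thesis by (simp add: formal_sum_def)
qed

text \<open>The innermost index is the exponent of q. Exponents add up, so those above
  \<open>a\<close> in a factor cannot reach \<open>a\<close> in the product; this lets truncation
  pass through products.\<close>

lemma series3_mult_cong:
  fixes C F G :: series3
  assumes "\<And>i j a'. a' \<le> a \<Longrightarrow> F $ i $ j $ a' = G $ i $ j $ a'"
  shows "(C * F) $ i $ j $ a = (C * G) $ i $ j $ a"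
  by (auto simp: fps_mult_nth fps_sum_nth assms intro!: sum.cong)

section \<open>Truncating the generating functions by the length of the walks\<close>

lemma finite_lists_le: "finite {w :: (bool \<times> bool) list. P w \<and> length w \<le> N}"
  by (rule finite_subset[OF _ finite_lists_length_le[of UNIV N]]) auto

text \<open>A walk longer than \<open>N\<close> has area greater than \<open>N\<close>, hence misses
  the exponent \<open>a\<close>.\<close>

lemma walk_gf_nth:
  assumes "a \<le> N"
  shows "walk_gf m k $ i $ j $ a =
    (\<Sum>w | walk m k w \<and> length w \<le> N. walk_weight k w) $ i $ j $ a"
  unfolding walk_gf_def
  by (rule formal_sum_nth) (use assms in \<open>auto simp: finite_lists_le intro: walk_weight_nth_eq_0\<close>)

text \<open>\<open>formal_sum\<close> is defined coefficient by coefficient, so a common factor is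
  pulled out of a finite truncation instead.\<close>

lemma formal_sum_walk_mult:
  "formal_sum (\<lambda>w. C * walk_weight k w) {w. walk m k w} = C * walk_gf m k"
proof -
  have "formal_sum (\<lambda>w. C * walk_weight k w) {w. walk m k w} $ i $ j $ a =
      (C * walk_gf m k) $ i $ j $ a" for i j a
  proof -
    have "(C * walk_weight k w) $ i $ j $ a = (C * 0) $ i $ j $ a"
      if "walk m k w" "\<not> length w \<le> a" for w
      by (rule series3_mult_cong) (use that walk_weight_nth_eq_0 in auto)
    then have "formal_sum (\<lambda>w. C * walk_weight k w) {w. walk m k w} $ i $ j $ a =
        (\<Sum>w | walk m k w \<and> length w \<le> a. C * walk_weight k w) $ i $ j $ a"
      by (intro formal_sum_nth) (auto simp: finite_lists_le)
    also have "\<dots> = (C * (\<Sum>w | walk m k w \<and> length w \<le> a. walk_weight k w)) $ i $ j $ a"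
      by (simp add: sum_distrib_left)
    also have "\<dots> = (C * walk_gf m k) $ i $ j $ a"
      by (rule series3_mult_cong) (simp add: walk_gf_nth)
    finally show ?thesis .
  qed
  then show ?thesis by (simp add: fps_eq_iff)
qed

lemma walk_gf_outside: "k = 0 \<or> m < k \<Longrightarrow> walk_gf m k = 0"
proof -
  assume "k = 0 \<or> m < k"
  then have "{w. walk m k w} = {}" using walk_height[of m k] by fastforce
  then show ?thesis by (simp add: walk_gf_def formal_sum_def fps_eq_iff)
qed

text \<open>The first step is split off in the finite sums \<open>Z k N\<close>, and the result is
  transferred one coefficient at a time.\<close>

lemma walk_gf_rec_sum:
  assumes "1 \<le> k" "k \<le> m"
  shows "walk_gf m k = qv ^ k * (of_bool (k = 1) +
    (\<Sum>s\<in>UNIV. step_weight s * walk_gf m (next_height k s)))"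
proof -
  define Z where "Z k N = (\<Sum>w | walk m k w \<and> length w \<le> N. walk_weight k w)" for k N
  have Z_Suc: "Z k (Suc N) = qv ^ k * (of_bool (k = 1) +
      (\<Sum>s\<in>UNIV. step_weight s * Z (next_height k s) N))" for N
  proof -
    let ?A = "\<lambda>s. {w. walk m (next_height k s) w \<and> length w \<le> N}"
    \<comment> \<open>The empty walk ends where it starts, so it occurs only at height 1.\<close>
    have split: "{w. walk m k w \<and> length w \<le> Suc N} =
        (if k = 1 then {[]} else {}) \<union> (\<Union>s\<in>UNIV. (#) s ` ?A s)"
    proof (intro set_eqI)
      fix w show "w \<in> {w. walk m k w \<and> length w \<le> Suc N} \<longleftrightarrow>
          w \<in> (if k = 1 then {[]} else {}) \<union> (\<Union>s\<in>UNIV. (#) s ` ?A s)"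
        using assms by (cases w) auto
    qed
    have "Z k (Suc N) = (\<Sum>w\<in>(if k = 1 then {[]} else {}). walk_weight k w) +
        (\<Sum>w\<in>(\<Union>s\<in>UNIV. (#) s ` ?A s). walk_weight k w)"
      unfolding Z_def split
      by (rule sum.union_disjoint) (auto simp: finite_lists_le)
    also have "(\<Sum>w\<in>(if k = 1 then {[]} else {}). walk_weight k w) = qv ^ k * of_bool (k = 1)"
      by simp
    also have "(\<Sum>w\<in>(\<Union>s\<in>UNIV. (#) s ` ?A s). walk_weight k w) =
        (\<Sum>s\<in>UNIV. \<Sum>w\<in>(#) s ` ?A s. walk_weight k w)"
      by (rule sum.UNION_disjoint) (auto simp: finite_lists_le)
    also have "\<dots> = (\<Sum>s\<in>UNIV. qv ^ k * (step_weight s * Z (next_height k s) N))"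
      by (rule sum.cong) (auto simp: Z_def sum_distrib_left sum.reindex)
    finally show ?thesis
      by (simp add: sum_distrib_left distrib_left)
  qed
  have nth: "walk_gf m k $ i $ j $ a = Z k N $ i $ j $ a" if "a \<le> N" for k i j a N
    using walk_gf_nth[OF that] by (simp add: Z_def)
  have "walk_gf m k $ i $ j $ a = (qv ^ k * (of_bool (k = 1) +
    (\<Sum>s\<in>UNIV. step_weight s * walk_gf m (next_height k s)))) $ i $ j $ a" for i j a
  proof -
    have "walk_gf m k $ i $ j $ a = Z k (Suc a) $ i $ j $ a"
      by (rule nth) simp
    \<comment> \<open>Truncation at \<open>Suc a\<close> leaves lengths up to \<open>a\<close> after
      the first step, still enough for exponent \<open>a\<close>.\<close>
    also have "\<dots> = (qv ^ k * (of_bool (k = 1) +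
        (\<Sum>s\<in>UNIV. step_weight s * walk_gf m (next_height k s)))) $ i $ j $ a"
      unfolding Z_Suc
      by (intro series3_mult_cong)
        (auto simp: fps_sum_nth simp flip: nth intro!: sum.cong series3_mult_cong)
    finally show ?thesis .
  qed
  then show ?thesis by (simp add: fps_eq_iff)
qed

text \<open>Two of the four steps keep the height, one with each weight; raising it has weight
  \<open>qnu\<close>, lowering it \<open>qnu * zv ^ 2\<close>.\<close>

lemma walk_gf_rec:
  assumes "1 \<le> k" "k \<le> m"
  shows "walk_gf m k = qv ^ k * (of_bool (k = 1) + qnu * (1 + zv ^ 2) * walk_gf m k +
    qnu * walk_gf m (Suc k) + qnu * zv ^ 2 * walk_gf m (k - 1))"
proof -
  have UNIV_eq: "(UNIV :: (bool \<times> bool) set) =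
      {(True, True), (False, False), (True, False), (False, True)}"
    by (auto simp: UNIV_bool)
  show ?thesis
    by (subst walk_gf_rec_sum[OF assms], unfold UNIV_eq)
      (simp add: step_weight_def next_height_def algebra_simps)
qed

section \<open>Skew shapes as convex sets\<close>

lemma downset_nat_eq_lessThan:
  fixes D :: "nat set"
  assumes "finite D" "\<And>x y. \<lbrakk>x \<in> D; y \<le> x\<rbrakk> \<Longrightarrow> y \<in> D"
  shows "D = {..<card D}"
proof (cases "D = {}")
  case False
  then have "D = {..Max D}"
    using assms(2)[OF Max_in[OF assms(1) False]] assms(1) by (auto intro: Max_ge)
  then show ?thesis by (metis card_atMost lessThan_Suc_atMost)
qed auto

text \<open>The rows are initial segments of weakly decreasing length. Stopping at the first empty
  row, which column 0 detects, keeps the parts positive.\<close>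

lemma downset_young_diagram:
  assumes fin: "finite S"
    and down: "\<And>i j i' j'. \<lbrakk>(i, j) \<in> S; i' \<le> i; j' \<le> j\<rbrakk> \<Longrightarrow> (i', j') \<in> S"
  shows "\<exists>\<sigma>. is_partition \<sigma> \<and> S = young_diagram \<sigma>"
proof -
  define r where "r i = card {j. (i, j) \<in> S}" for i
  define n where "n = card {i. (i, 0) \<in> S}"
  have fin_row: "finite {j. (i, j) \<in> S}" for i
    by (rule finite_subset[of _ "snd ` S"]) (use fin in force)+
  have row: "(i, j) \<in> S \<longleftrightarrow> j < r i" for i j
  proof -
    have "{j. (i, j) \<in> S} = {..<r i}"
      unfolding r_def by (rule downset_nat_eq_lessThan[OF fin_row]) (use down in blast)
    then show ?thesis by blast
  qed
  have "{i. (i, 0) \<in> S} = {..<n}"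
    unfolding n_def
  proof (rule downset_nat_eq_lessThan)
    show "finite {i. (i, 0) \<in> S}"
      by (rule finite_subset[of _ "fst ` S"]) (use fin in force)+
  qed (use down in blast)
  then have col: "0 < r i \<longleftrightarrow> i < n" for i
    using row by blast
  have anti: "r i \<le> r i'" if "i' \<le> i" for i i'
    unfolding r_def by (rule card_mono[OF fin_row]) (use down that in blast)
  show ?thesis
  proof (intro exI conjI)
    show "is_partition (map r [0..<n])"
      using anti col by (auto simp: is_partition_def sorted_wrt_iff_nth_less)
    have "(i, j) \<in> S \<longleftrightarrow> i < n \<and> j < r i" for i j
      using row[of i j] col[of i] by auto
    then show "S = young_diagram (map r [0..<n])"
      by (auto simp: young_diagram_def)
  qed
qed

lemma young_diagram_down:
  assumes "is_partition \<sigma>" "(i, j) \<in> young_diagram \<sigma>" "i' \<le> i" "j' \<le> j"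
  shows "(i', j') \<in> young_diagram \<sigma>"
proof -
  have "\<sigma> ! i \<le> \<sigma> ! i'"
    using assms sorted_wrt_nth_less[of "(\<ge>)" \<sigma> i' i]
    by (cases "i' = i") (auto simp: is_partition_def young_diagram_def)
  then show ?thesis using assms by (auto simp: young_diagram_def)
qed

definition order_convex :: "shape \<Rightarrow> bool" where
  "order_convex A \<longleftrightarrow> (\<forall>i j i1 j1 i2 j2. (i1, j1) \<in> A \<longrightarrow> (i2, j2) \<in> A \<longrightarrow>
     i1 \<le> i \<longrightarrow> i \<le> i2 \<longrightarrow> j1 \<le> j \<longrightarrow> j \<le> j2 \<longrightarrow> (i, j) \<in> A)"

lemma order_convexD:
  "\<lbrakk>order_convex A; (i1, j1) \<in> A; (i2, j2) \<in> A; i1 \<le> i; i \<le> i2; j1 \<le> j; j \<le> j2\<rbrakk>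
    \<Longrightarrow> (i, j) \<in> A"
  unfolding order_convex_def by blast

text \<open>This describes skew shapes without naming the two partitions, in a form that can be
  checked diagonal by diagonal.\<close>

lemma skew_shape_iff_order_convex: "skew_shape A \<longleftrightarrow> finite A \<and> order_convex A"
proof
  assume A: "skew_shape A"
  then obtain \<sigma> \<rho> where "is_partition \<sigma>" "is_partition \<rho>" "A = young_diagram \<sigma> - young_diagram \<rho>"
    unfolding skew_shape_def by blast
  then have "order_convex A"
    unfolding order_convex_def by (blast intro: young_diagram_down)
  with A show "finite A \<and> order_convex A" by (simp add: finite_skew_shape)
next
  assume A: "finite A \<and> order_convex A"
  \<comment> \<open>The outer diagram is the down-closure of \<open>A\<close>; the inner one is
    \<open>S - A\<close>.\<close>
  define S where "S = {(i, j). \<exists>(i', j')\<in>A. i \<le> i' \<and> j \<le> j'}"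
  have "S \<subseteq> (\<Union>(i', j')\<in>A. {..i'} \<times> {..j'})"
    by (auto simp: S_def)
  then have fin: "finite S"
    by (rule finite_subset) (use A in auto)
  have down: "(i', j') \<in> S" if "(i, j) \<in> S" "i' \<le> i" "j' \<le> j" for i j i' j'
    using that le_trans unfolding S_def by blast
  \<comment> \<open>If \<open>(i', j')\<close> were in \<open>A\<close>, then \<open>(i, j)\<close>,
    lying between it and a square of \<open>A\<close>, would be in \<open>A\<close> by
    convexity.\<close>
  have down': "(i', j') \<in> S - A" if "(i, j) \<in> S - A" "i' \<le> i" "j' \<le> j" for i j i' j'
  proof -
    obtain i2 j2 where "(i2, j2) \<in> A" "i \<le> i2" "j \<le> j2"
      using \<open>(i, j) \<in> S - A\<close> by (auto simp: S_def)
    then have "(i', j') \<notin> A"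
      using A that order_convexD[of A i' j' i2 j2 i j] by auto
    then show ?thesis using down that by blast
  qed
  obtain \<sigma> where \<sigma>: "is_partition \<sigma>" "S = young_diagram \<sigma>"
    using downset_young_diagram[OF fin] down by blast
  have "finite (S - A)" using fin by blast
  then obtain \<rho> where \<rho>: "is_partition \<rho>" "S - A = young_diagram \<rho>"
    using downset_young_diagram[of "S - A"] down' by blast
  have "A \<subseteq> S" by (auto simp: S_def)
  then have "young_diagram \<rho> \<subseteq> young_diagram \<sigma>" "A = young_diagram \<sigma> - young_diagram \<rho>"
    by (auto simp flip: \<sigma>(2) \<rho>(2))
  then show "skew_shape A"
    using \<sigma>(1) \<rho>(1) unfolding skew_shape_def by blast
qed

section \<open>From walks to shapes\<close>

text \<open>For \<open>P = fst\<close> and \<open>P = snd\<close>: how far the upper and the lower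
  end have moved after \<open>t\<close> steps.\<close>

definition count_upto :: "('a \<Rightarrow> bool) \<Rightarrow> 'a list \<Rightarrow> nat \<Rightarrow> nat" where
  "count_upto P w t = length (filter P (take t w))"

lemma count_upto_0 [simp]: "count_upto P w 0 = 0"
  by (simp add: count_upto_def)

lemma count_upto_Suc: "t < length w \<Longrightarrow> count_upto P w (Suc t) = count_upto P w t + of_bool (P (w ! t))"
  by (simp add: count_upto_def take_Suc_conv_app_nth)

lemma count_upto_Cons_Suc [simp]:
  "count_upto P (s # w) (Suc t) = of_bool (P s) + count_upto P w t"
  by (simp add: count_upto_def)

lemma count_upto_length: "count_upto P w (length w) = length (filter P w)"
  by (simp add: count_upto_def)

lemma count_upto_mono:
  assumes "t \<le> t'"
  shows "count_upto P w t \<le> count_upto P w t'"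
    and "count_upto P w t' \<le> count_upto P w t + (t' - t)"
proof -
  have eq: "take t' w = take t w @ take (t' - t) (drop t w)"
    by (metis assms le_add_diff_inverse take_add)
  have "length (filter P (take (t' - t) (drop t w))) \<le> t' - t"
    by (metis length_filter_le length_take le_trans min.cobounded2)
  then show "count_upto P w t \<le> count_upto P w t'"
    "count_upto P w t' \<le> count_upto P w t + (t' - t)"
    by (simp_all add: count_upto_def eq)
qed

lemma count_upto_le: "count_upto P w t \<le> t"
  using count_upto_mono(2)[of 0 t P w] by simp

text \<open>The height after \<open>t\<close> steps is
  \<open>k + count_upto fst w t - count_upto snd w t\<close>; its bounds are stated without
  subtraction.\<close>

lemma walk_iff:
  "walk m k w \<longleftrightarrow>
    (\<forall>t\<le>length w. count_upto snd w t < k + count_upto fst w t \<and>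
       k + count_upto fst w t \<le> m + count_upto snd w t) \<and>
    k + count_upto fst w (length w) = Suc (count_upto snd w (length w))"
proof (induction w arbitrary: k)
  case (Cons s w)
  have all: "(\<forall>t\<le>Suc n. P t) \<longleftrightarrow> P 0 \<and> (\<forall>t\<le>n. P (Suc t))" for P and n :: nat
    by (metis Suc_le_mono le0 not0_implies_Suc)
  show ?case
  proof (cases "1 \<le> k")
    case True
    then have "next_height k s + of_bool (snd s) = k + of_bool (fst s)"
      by (simp add: next_height_def)
    then show ?thesis
      by (cases "fst s"; cases "snd s") (auto simp: Cons.IH all)
  qed auto
qed auto

lemma walk_area_eq_sum:
  "walk m k w \<Longrightarrow> walk_area k w =
    (\<Sum>t\<le>length w. k + count_upto fst w t - count_upto snd w t)"
proof (induction w arbitrary: k)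
  case (Cons s w)
  then have "1 \<le> k" by simp
  \<comment> \<open>The truncated subtraction in \<open>next_height\<close> is exact since
    \<open>1 <= k\<close>, so it merges with that of the counts.\<close>
  then have height: "next_height k s + c - d = k + (of_bool (fst s) + c) - (of_bool (snd s) + d)"
    for c d
    by (simp add: next_height_def)
  have "walk_area k (s # w) =
      k + (\<Sum>t\<le>length w. next_height k s + count_upto fst w t - count_upto snd w t)"
    using Cons by simp
  also have "\<dots> = k + (\<Sum>t\<le>length w.
      k + count_upto fst (s # w) (Suc t) - count_upto snd (s # w) (Suc t))"
    by (simp only: height count_upto_Cons_Suc)
  also have "\<dots> = (\<Sum>t\<le>length (s # w).
      k + count_upto fst (s # w) t - count_upto snd (s # w) t)"
    by (simp add: sum.atMost_Suc_shift del: sum.atMost_Suc count_upto_Cons_Suc)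
  finally show ?case .
qed auto

lemma walk_zero_heightD:
  assumes "walk m 1 w"
  shows "t \<le> length w \<Longrightarrow> count_upto snd w t \<le> count_upto fst w t"
    and "t \<le> length w \<Longrightarrow> count_upto fst w t < m + count_upto snd w t"
    and "count_upto snd w (length w) = count_upto fst w (length w)"
  using assms unfolding walk_iff by auto

text \<open>
  The t-th diagonal of the shape consists of the squares in rows r - (number of first
  components among the first t steps) to r - (number of second components). Both ends move
  up by at most one row from one diagonal to the next; all subtractions are moved to the other side.
\<close>

definition walk_shape :: "(bool \<times> bool) list \<Rightarrow> shape" where
  "walk_shape w = {(i, j). \<exists>t\<le>length w. length (filter fst w) \<le> i + count_upto fst w t \<and>
     i + count_upto snd w t \<le> length (filter fst w) \<and> j + length (filter fst w) = i + t}"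

text \<open>A square determines the number of its diagonal, which removes the existential
  quantifier.\<close>

lemma walk_shape_iff:
  assumes "i + t = j + length (filter fst w)"
  shows "(i, j) \<in> walk_shape w \<longleftrightarrow> t \<le> length w \<and>
    length (filter fst w) \<le> i + count_upto fst w t \<and> i + count_upto snd w t \<le> length (filter fst w)"
  using assms by (auto simp: walk_shape_def)

context
  fixes m w
  assumes walk: "walk m 1 w"
begin

lemmas zero_height = walk_zero_heightD[OF walk]

lemma walk_shape_le:
  assumes "(i, j) \<in> walk_shape w"
  shows "i \<le> length (filter fst w)" "j + length (filter fst w) \<le> length w"
proof -
  obtain t where t: "t \<le> length w" "length (filter fst w) \<le> i + count_upto fst w t"
    "i + count_upto snd w t \<le> length (filter fst w)" "j + length (filter fst w) = i + t"
    using assms by (auto simp: walk_shape_def)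
  then show "i \<le> length (filter fst w)" by simp
  \<comment> \<open>The walk returns to height 1, so both components hold equally often in total,
    and at most \<open>length w - t\<close> of the moves of the lower end come after step
    \<open>t\<close>.\<close>
  have "length (filter fst w) \<le> count_upto snd w t + (length w - t)"
    using count_upto_mono(2)[OF t(1), of snd w] zero_height(3) by (simp add: count_upto_length)
  with t show "j + length (filter fst w) \<le> length w" by linarith
qed

text \<open>The first and last diagonals are single squares. They anchor the row and column counts
  and fix the position of the shape.\<close>

lemma walk_shape_corners:
  "(length (filter fst w), 0) \<in> walk_shape w"
  "(0, length w - length (filter fst w)) \<in> walk_shape w"
proof -
  show "(length (filter fst w), 0) \<in> walk_shape w"
    by (subst walk_shape_iff[of _ 0]) auto
  show "(0, length w - length (filter fst w)) \<in> walk_shape w"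
    using zero_height(3)
    by (subst walk_shape_iff[of _ "length w"]) (auto simp: count_upto_length)
qed

lemma finite_walk_shape: "finite (walk_shape w)"
  by (rule finite_subset[of _ "{..length (filter fst w)} \<times> {..length w}"])
    (use walk_shape_le in fastforce)+

lemma order_convex_walk_shape: "order_convex (walk_shape w)"
  unfolding order_convex_def
proof (intro allI impI)
  fix i j i1 j1 i2 j2
  assume mem: "(i1, j1) \<in> walk_shape w" "(i2, j2) \<in> walk_shape w"
    and le: "i1 \<le> i" "i \<le> i2" "j1 \<le> j" "j \<le> j2"
  let ?r = "length (filter fst w)" and ?a = "count_upto fst w" and ?b = "count_upto snd w"
  obtain t1 where t1: "t1 \<le> length w" "?r \<le> i1 + ?a t1" "i1 + ?b t1 \<le> ?r" "j1 + ?r = i1 + t1"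
    using mem(1) by (auto simp: walk_shape_def)
  obtain t2 where t2: "t2 \<le> length w" "?r \<le> i2 + ?a t2" "i2 + ?b t2 \<le> ?r" "j2 + ?r = i2 + t2"
    using mem(2) by (auto simp: walk_shape_def)
  have "i \<le> ?r" "j + ?r \<le> length w"
    using walk_shape_le[OF mem(2)] le by linarith+
  then obtain t where t: "i + t = j + ?r" "t \<le> length w"
    by (intro that[of "j + ?r - i"]) auto
  \<comment> \<open>If \<open>t < t1\<close>, the upper end has moved at most \<open>t1 - t\<close>
    less, and \<open>t1 - t <= i - i1\<close> because \<open>j1 <= j\<close>. The lower end is
    treated symmetrically with \<open>t2\<close>.\<close>
  have "?r \<le> i + ?a t"
  proof (cases "t1 \<le> t")
    case True
    then show ?thesis using count_upto_mono(1)[OF True, of fst w] t1 le by linarith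
  next
    case False
    then show ?thesis using count_upto_mono(2)[of t t1 fst w] t1 le t by linarith
  qed
  moreover have "i + ?b t \<le> ?r"
  proof (cases "t \<le> t2")
    case True
    then show ?thesis using count_upto_mono(1)[OF True, of snd w] t2 le by linarith
  next
    case False
    then show ?thesis using count_upto_mono(2)[of t2 t snd w] t2 le t by linarith
  qed
  ultimately show "(i, j) \<in> walk_shape w"
    using t by (simp add: walk_shape_iff)
qed

lemma skew_shape_walk_shape: "skew_shape (walk_shape w)"
  by (simp add: skew_shape_iff_order_convex finite_walk_shape order_convex_walk_shape)

text \<open>Each square beyond the first diagonal has its left or its lower neighbour on the
  preceding diagonal, so every square is reached from the lower left corner.\<close>

lemma connected_walk_shape: "connected_shape (walk_shape w)"
proof -
  let ?r = "length (filter fst w)" and ?a = "count_upto fst w" and ?b = "count_upto snd w"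
  let ?E = "{(u, v). u \<in> walk_shape w \<and> v \<in> walk_shape w \<and> share_edge u v}"
  have reach: "((?r, 0), (i, j)) \<in> ?E\<^sup>*"
    if "(i, j) \<in> walk_shape w" "i + t = j + ?r" for i j t
    using that
  proof (induction t arbitrary: i j)
    case 0
    then have "i = ?r" "j = 0"
      by (auto simp: walk_shape_iff[of i 0])
    then show ?case by simp
  next
    case (Suc t)
    then have t: "Suc t \<le> length w" "?r \<le> i + ?a (Suc t)" "i + ?b (Suc t) \<le> ?r"
      by (auto simp: walk_shape_iff[of i "Suc t"])
    have ab: "?a t \<le> ?a (Suc t)" "?a (Suc t) \<le> Suc (?a t)" "?b t \<le> ?b (Suc t)" "?b t \<le> ?a t"
      using t(1) zero_height(1)[of t] count_upto_mono[of t "Suc t" fst w]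
        count_upto_mono[of t "Suc t" snd w] by auto
    show ?case
    proof (cases "?r \<le> i + ?a t")
      case True
      \<comment> \<open>At most \<open>t\<close> rows were gained in \<open>t\<close> steps, so a
        left neighbour exists.\<close>
      then have "0 < j"
        using Suc.prems(2) count_upto_le[of fst w t] by linarith
      then obtain j' where j': "j = Suc j'"
        by (cases j) auto
      have "(i, j') \<in> walk_shape w"
        using True t ab Suc.prems(2) j' by (subst walk_shape_iff[of i t]) auto
      moreover have "share_edge (i, j') (i, j)"
        by (simp add: share_edge_def j')
      ultimately show ?thesis
        using Suc.IH[of i j'] Suc.prems j' by (auto intro: rtrancl_into_rtrancl)
    next
      case False
      then have "(Suc i, j) \<in> walk_shape w"
        using t ab Suc.prems(2) by (subst walk_shape_iff[of "Suc i" t]) auto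
      moreover have "share_edge (Suc i, j) (i, j)"
        by (simp add: share_edge_def)
      ultimately show ?thesis
        using Suc.IH[of "Suc i" j] Suc.prems by (auto intro: rtrancl_into_rtrancl)
    qed
  qed
  have reach': "((?r, 0), s) \<in> ?E\<^sup>*" if "s \<in> walk_shape w" for s
  proof -
    obtain i j where s: "s = (i, j)" by force
    then have "\<exists>t. i + t = j + ?r" using that by (auto simp: walk_shape_def)
    then show ?thesis using that s reach by blast
  qed
  have "sym ?E" by (auto simp: sym_def share_edge_def)
  then have "sym (?E\<^sup>*)" by (rule sym_rtrancl)
  then have "(s, t) \<in> ?E\<^sup>*" if "s \<in> walk_shape w" "t \<in> walk_shape w" for s t
    using reach' that by (meson rtrancl_trans symE)
  then show ?thesis unfolding connected_shape_def by blast
qed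

text \<open>Connectedness fills all rows between those of the two corners.\<close>

lemma row_walk_shape: "row_shape (walk_shape w) = Suc (length (filter fst w))"
proof -
  have "fst ` walk_shape w = {..length (filter fst w)}"
    using walk_shape_le(1) connected_shape_rows[OF connected_walk_shape walk_shape_corners(2,1)]
    by fastforce
  then show ?thesis by (simp add: row_shape_def)
qed

lemma col_walk_shape: "col_shape (walk_shape w) = Suc (length (filter (Not \<circ> fst) w))"
proof -
  have eq: "length w = length (filter fst w) + length (filter (Not \<circ> fst) w)"
    using sum_length_filter_compl[of fst w] by (simp add: comp_def)
  have "snd ` walk_shape w = {..length (filter (Not \<circ> fst) w)}"
    using walk_shape_le(2) connected_shape_cols[OF connected_walk_shape walk_shape_corners]
    by (fastforce simp: eq)
  then show ?thesis by (simp add: col_shape_def)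
qed

text \<open>Squares are counted in the coordinates (diagonal, row).\<close>

lemma area_walk_shape: "area_shape (walk_shape w) = walk_area 1 w"
proof -
  let ?r = "length (filter fst w)" and ?a = "count_upto fst w" and ?b = "count_upto snd w"
  let ?S = "SIGMA t:{..length w}. {?r - ?a t..?r - ?b t}"
  let ?f = "\<lambda>(t, i). (i, i + t - ?r)"
  have ar: "?a t \<le> ?r" if "t \<le> length w" for t
    using count_upto_mono(1)[OF that, of fst w] by (simp add: count_upto_length)
  \<comment> \<open>This makes the subtraction in \<open>?f\<close> exact, as its injectivity
    requires.\<close>
  have rt: "?r \<le> i + t" if "?r \<le> i + ?a t" for i t
    using that count_upto_le[of fst w t] by linarith
  have eq: "walk_shape w = ?f ` ?S"
  proof (intro set_eqI iffI)
    fix s assume "s \<in> walk_shape w"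
    then obtain i j t where "s = (i, j)" "t \<le> length w" "?r \<le> i + ?a t" "i + ?b t \<le> ?r"
      "j + ?r = i + t" by (auto simp: walk_shape_def)
    then show "s \<in> ?f ` ?S"
      by (intro image_eqI[of _ _ "(t, i)"]) auto
  next
    fix s assume "s \<in> ?f ` ?S"
    then obtain t i where s: "s = (i, i + t - ?r)" "t \<le> length w" "?r - ?a t \<le> i" "i \<le> ?r - ?b t"
      by auto
    then have "?r \<le> i + ?a t" "i + ?b t \<le> ?r"
      using ar[of t] zero_height(1)[of t] by linarith+
    with s rt[of i t] show "s \<in> walk_shape w"
      by (auto simp: walk_shape_iff[of i t])
  qed
  have "inj_on ?f ?S"
  proof (rule inj_onI)
    fix p p' assume "p \<in> ?S" "p' \<in> ?S" "?f p = ?f p'"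
    then obtain t t' i where p: "p = (t, i)" "p' = (t', i)" "?r \<le> i + ?a t" "?r \<le> i + ?a t'"
      "i + t - ?r = i + t' - ?r"
      by (cases p; cases p') auto
    then have "t = t'" using rt[of i t] rt[of i t'] by linarith
    with p show "p = p'" by simp
  qed
  then have "card (walk_shape w) = card ?S"
    unfolding eq by (rule card_image)
  also have "\<dots> = (\<Sum>t\<le>length w. card {?r - ?a t..?r - ?b t})"
    by simp
  also have "\<dots> = (\<Sum>t\<le>length w. 1 + ?a t - ?b t)"
    by (intro sum.cong) (use ar zero_height(1) in fastforce)+
  finally show ?thesis
    by (simp only: area_shape_def walk_area_eq_sum[OF walk])
qed

lemma diagonal_walk_shape: "card (diagonal (walk_shape w) k) \<le> m"
proof (cases "diagonal (walk_shape w) k = {}")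
  case False
  let ?r = "length (filter fst w)" and ?a = "count_upto fst w" and ?b = "count_upto snd w"
  obtain i0 j0 t where t: "int i0 - int j0 = k" "j0 + ?r = i0 + t" "t \<le> length w"
    using False by (auto simp: diagonal_def walk_shape_def)
  have "card (diagonal (walk_shape w) k) \<le> card {?r - ?a t..?r - ?b t}"
  proof (rule card_inj_on_le[of fst])
    show "inj_on fst (diagonal (walk_shape w) k)"
      by (auto simp: inj_on_def diagonal_def)
    show "fst ` diagonal (walk_shape w) k \<subseteq> {?r - ?a t..?r - ?b t}"
    proof
      fix i assume "i \<in> fst ` diagonal (walk_shape w) k"
      then obtain j where ij: "(i, j) \<in> diagonal (walk_shape w) k" by force
      then have "i + t = j + ?r" using t by (auto simp: diagonal_def)
      then show "i \<in> {?r - ?a t..?r - ?b t}"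
        using ij by (auto simp: diagonal_def walk_shape_iff[of i t])
    qed
  qed simp
  also have "\<dots> \<le> m"
    using zero_height(1,2)[OF t(3)] by auto
  finally show ?thesis .
qed simp

end

section \<open>From shapes to walks\<close>

lemma list_eqI_count_upto:
  assumes "length w = length w'"
    and "\<And>t. t \<le> length w \<Longrightarrow> count_upto fst w t = count_upto fst w' t"
    and "\<And>t. t \<le> length w \<Longrightarrow> count_upto snd w t = count_upto snd w' t"
  shows "w = w'"
proof (rule nth_equalityI[OF assms(1)])
  fix t assume t: "t < length w"
  have "P (w ! t) = P (w' ! t)"
    if "\<And>t. t \<le> length w \<Longrightarrow> count_upto P w t = count_upto P w' t" for P
  proof -
    have "(of_bool (P (w ! t)) :: nat) = of_bool (P (w' ! t))"
      using that[of t] that[of "Suc t"] t assms(1) by (simp add: count_upto_Suc)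
    then show ?thesis by (simp only: of_bool_eq_iff)
  qed
  from this[of fst] this[of snd] have "fst (w ! t) = fst (w' ! t)" "snd (w ! t) = snd (w' ! t)"
    using assms(2,3) by simp_all
  then show "w ! t = w' ! t" by (rule prod_eqI)
qed

text \<open>Row and column counts recover the length and the starting row; then the interval of rows
  on each diagonal recovers both counts.\<close>

lemma walk_shape_inj:
  assumes walk: "walk m 1 w" "walk m 1 w'" and eq: "walk_shape w = walk_shape w'"
  shows "w = w'"
proof -
  have r: "length (filter fst w) = length (filter fst w')"
    using row_walk_shape[OF walk(1)] row_walk_shape[OF walk(2)] eq by simp
  have "length (filter (Not \<circ> fst) w) = length (filter (Not \<circ> fst) w')"
    using col_walk_shape[OF walk(1)] col_walk_shape[OF walk(2)] eq by simp
  with r have n: "length w = length w'"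
    using sum_length_filter_compl[of fst w] sum_length_filter_compl[of fst w'] by (simp add: comp_def)
  have rows: "i + count_upto snd w' t \<le> length (filter fst w) \<and>
      length (filter fst w) \<le> i + count_upto fst w' t"
    if "t \<le> length w" "length (filter fst w) \<le> i + count_upto fst w t"
      "i + count_upto snd w t \<le> length (filter fst w)"
      "walk_shape w = walk_shape w'" "length (filter fst w) = length (filter fst w')" for i t w w'
  proof -
    have "length (filter fst w) \<le> i + t"
      using that(2) count_upto_le[of fst w t] by linarith
    then have it: "i + t = (i + t - length (filter fst w)) + length (filter fst w)" by simp
    then have "(i, i + t - length (filter fst w)) \<in> walk_shape w"
      using that(1-3) by (subst walk_shape_iff[OF it]) simp
    then show ?thesis
      using it unfolding that(4,5) by (subst (asm) walk_shape_iff) auto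
  qed
  \<comment> \<open>Applying \<open>rows\<close> to the two end rows of an interval gives one
    inclusion; exchanging the walks gives the other.\<close>
  have ends: "count_upto fst w t \<le> count_upto fst w' t \<and> count_upto snd w' t \<le> count_upto snd w t"
    if "walk m 1 w" "walk_shape w = walk_shape w'" "length (filter fst w) = length (filter fst w')"
      "t \<le> length w" for t w w'
  proof -
    let ?r = "length (filter fst w)"
    have le: "count_upto fst w t \<le> ?r" "count_upto snd w t \<le> count_upto fst w t"
      using count_upto_mono(1)[OF that(4), of fst w] zero_height(1)[OF that(1,4)]
      by (simp_all add: count_upto_length)
    have "?r - count_upto fst w t + count_upto snd w' t \<le> ?r \<and>
        ?r \<le> ?r - count_upto fst w t + count_upto fst w' t"
      by (rule rows) (use le that in auto)
    moreover have "?r - count_upto snd w t + count_upto snd w' t \<le> ?r \<and>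
        ?r \<le> ?r - count_upto snd w t + count_upto fst w' t"
      by (rule rows) (use le that in auto)
    ultimately show ?thesis using le by linarith
  qed
  show ?thesis
    using ends[of w w'] ends[of w' w] walk eq r n by (intro list_eqI_count_upto n) (auto intro: le_antisym)
qed

lemma walk_shape_translate_inj:
  assumes walk: "walk m 1 w" "walk m 1 w'" and tr: "translate_of (walk_shape w) (walk_shape w')"
  shows "w = w'"
proof -
  obtain a b :: int where
    ab: "(\<lambda>(i, j). (int i + a, int j + b)) ` walk_shape w = map_prod int int ` walk_shape w'"
    using tr unfolding translate_of_def by blast
  have fwd: "\<exists>i' j'. (i', j') \<in> walk_shape w' \<and> int i' = int i + a \<and> int j' = int j + b"
    if "(i, j) \<in> walk_shape w" for i j
  proof -
    have "(int i + a, int j + b) \<in> map_prod int int ` walk_shape w'"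
      using that unfolding ab[symmetric] by force
    then show ?thesis by force
  qed
  have bwd: "\<exists>i j. (i, j) \<in> walk_shape w \<and> int i' = int i + a \<and> int j' = int j + b"
    if "(i', j') \<in> walk_shape w'" for i' j'
  proof -
    have "(int i', int j') \<in> (\<lambda>(i, j). (int i + a, int j + b)) ` walk_shape w"
      using that unfolding ab by force
    then show ?thesis by force
  qed
  \<comment> \<open>Both shapes touch row 0 and column 0, so neither can be shifted in any
    direction.\<close>
  have "a = 0"
    using fwd[OF walk_shape_corners(2)[OF walk(1)]] bwd[OF walk_shape_corners(2)[OF walk(2)]]
    by auto
  moreover have "b = 0"
    using fwd[OF walk_shape_corners(1)[OF walk(1)]] bwd[OF walk_shape_corners(1)[OF walk(2)]]
    by auto
  ultimately have "walk_shape w = walk_shape w'"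
    using fwd bwd by auto
  with walk show ?thesis by (rule walk_shape_inj)
qed

text \<open>A discrete intermediate value argument: an edge changes \<open>j - i\<close> by exactly
  1, so the edge of a path that passes \<open>c\<close> goes one square right or one square
  up.\<close>

lemma connected_shape_crossing:
  fixes c :: int
  assumes conn: "connected_shape A" and mem: "s \<in> A" "t \<in> A"
    and le: "int (snd s) - int (fst s) \<le> c" "c < int (snd t) - int (fst t)"
  obtains i j where "(i, j) \<in> A" "int j - int i = c" "(i, Suc j) \<in> A"
  | i j where "(Suc i, j) \<in> A" "int j - int (Suc i) = c" "(i, j) \<in> A"
proof -
  have "(s, t) \<in> {(u, v). u \<in> A \<and> v \<in> A \<and> share_edge u v}\<^sup>*"
    using conn mem unfolding connected_shape_def by blast
  then have "\<exists>u v. u \<in> A \<and> v \<in> A \<and> share_edge u v \<and> int (snd u) - int (fst u) \<le> c \<and>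
      c < int (snd v) - int (fst v)"
    using le(2)
  proof (induction rule: rtrancl_induct)
    case base
    then show ?case using le(1) by simp
  next
    case (step y z)
    show ?case
    proof (cases "c < int (snd y) - int (fst y)")
      case True
      then show ?thesis by (rule step.IH)
    next
      case False
      then show ?thesis using step by (intro exI[of _ y] exI[of _ z]) auto
    qed
  qed
  then obtain u v where uv: "u \<in> A" "v \<in> A" "share_edge u v"
    "int (snd u) - int (fst u) \<le> c" "c < int (snd v) - int (fst v)"
    by blast
  obtain i j i' j' where ij: "u = (i, j)" "v = (i', j')" by (cases u; cases v) auto
  have "i' = i \<and> j' = Suc j \<or> i = Suc i' \<and> j' = j"
    using uv(3-5) by (auto simp: share_edge_def ij)
  then show thesis
    using uv that unfolding ij by fastforce
qed

section \<open>The diagonals of a connected convex set\<close>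

locale connected_skew =
  fixes A :: shape
  assumes fin: "finite A" and conv: "order_convex A" and ne: "A \<noteq> {}" and conn: "connected_shape A"
begin

text \<open>The index is \<open>j - i\<close>, the negative of that in \<open>diagonal\<close>, so
  that it grows from the lower left to the upper right.\<close>

definition rows_on :: "int \<Rightarrow> nat set" where
  "rows_on c = {i. \<exists>j. (i, j) \<in> A \<and> int j - int i = c}"

definition contents :: "int set" where
  "contents = (\<lambda>(i, j). int j - int i) ` A"

definition low :: int where "low = Min contents"
definition high :: int where "high = Max contents"
definition top_row :: "int \<Rightarrow> nat" where "top_row c = Min (rows_on c)"
definition bottom_row :: "int \<Rightarrow> nat" where "bottom_row c = Max (rows_on c)"

lemma finite_rows_on: "finite (rows_on c)"
  by (rule finite_subset[of _ "fst ` A"]) (use fin in \<open>force simp: rows_on_def\<close>)+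

lemma mem_iff: "(i, j) \<in> A \<longleftrightarrow> i \<in> rows_on (int j - int i)"
  by (auto simp: rows_on_def)

lemma finite_contents: "finite contents" and contents_ne: "contents \<noteq> {}"
  using fin ne by (auto simp: contents_def)

lemma rows_on_ne_iff: "rows_on c \<noteq> {} \<longleftrightarrow> c \<in> contents"
  by (force simp: rows_on_def contents_def)

lemma contents_crossing:
  assumes "low \<le> c" "c < high"
  obtains i where "i \<in> rows_on c" "i \<in> rows_on (c + 1)"
  | i where "Suc i \<in> rows_on c" "i \<in> rows_on (c + 1)"
proof -
  have "low \<in> contents" "high \<in> contents"
    unfolding low_def high_def using finite_contents contents_ne by auto
  then obtain s t where "s \<in> A" "t \<in> A" "int (snd s) - int (fst s) = low"
    "int (snd t) - int (fst t) = high"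
    by (force simp: contents_def)
  then show thesis
    using assms
    by (elim connected_shape_crossing[OF conn, of s t c])
      (use that in \<open>auto simp: mem_iff algebra_simps\<close>)
qed

lemma contents_eq: "contents = {low..high}"
proof
  show "contents \<subseteq> {low..high}"
    unfolding low_def high_def using finite_contents by auto
  have high: "high \<in> contents"
    unfolding high_def using finite_contents contents_ne by auto
  show "{low..high} \<subseteq> contents"
  proof
    fix c assume c: "c \<in> {low..high}"
    show "c \<in> contents"
    proof (cases "c = high")
      case False
      then show ?thesis
        using c contents_crossing[of c] rows_on_ne_iff[of c] by force
    qed (use high in simp)
  qed
qed

text \<open>This is convexity in the coordinates row and content, whose sum is the column.\<close>

lemma rows_on_convex:
  assumes "i1 \<in> rows_on c1" "i2 \<in> rows_on c2" "i1 \<le> i" "i \<le> i2"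
    "int i1 + c1 \<le> int i + c" "int i + c \<le> int i2 + c2"
  shows "i \<in> rows_on c"
proof -
  obtain j1 j2 where j: "(i1, j1) \<in> A" "int j1 - int i1 = c1" "(i2, j2) \<in> A" "int j2 - int i2 = c2"
    using assms(1,2) by (auto simp: rows_on_def)
  then have "0 \<le> int i + c" using assms by linarith
  then obtain j where "int j = int i + c" by (metis nonneg_int_cases)
  then have "int j - int i = c" "j1 \<le> j" "j \<le> j2" using j assms by linarith+
  then have "(i, j) \<in> A"
    using order_convexD[OF conv j(1,3) assms(3,4)] by blast
  then show ?thesis using \<open>int j - int i = c\<close> unfolding rows_on_def by blast
qed

context
  fixes c :: int
  assumes c: "low \<le> c" "c \<le> high"
begin

lemma rows_on_ne: "rows_on c \<noteq> {}"
  using c by (simp add: rows_on_ne_iff contents_eq)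

lemma top_row_mem: "top_row c \<in> rows_on c" and bottom_row_mem: "bottom_row c \<in> rows_on c"
  using rows_on_ne finite_rows_on by (auto simp: top_row_def bottom_row_def)

lemma rows_on_eq: "rows_on c = {top_row c..bottom_row c}"
proof
  show "rows_on c \<subseteq> {top_row c..bottom_row c}"
    using finite_rows_on by (auto simp: top_row_def bottom_row_def)
  show "{top_row c..bottom_row c} \<subseteq> rows_on c"
  proof
    fix i assume "i \<in> {top_row c..bottom_row c}"
    then show "i \<in> rows_on c"
      by (intro rows_on_convex[OF top_row_mem bottom_row_mem, of i c]) simp_all
  qed
qed

lemma top_le_bottom: "top_row c \<le> bottom_row c"
  using bottom_row_mem rows_on_eq by auto

end

lemma rows_on_outside: "\<not> (low \<le> c \<and> c \<le> high) \<Longrightarrow> rows_on c = {}"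
  using rows_on_ne_iff[of c] by (auto simp: contents_eq)

lemma low_le_high: "low \<le> high"
  using contents_eq contents_ne by auto

text \<open>If an end moved otherwise, convexity would force a square beyond an end of one of the
  two diagonals.\<close>

lemma row_steps:
  assumes "low \<le> c" "c < high"
  shows "top_row (c + 1) \<le> top_row c" "top_row c \<le> Suc (top_row (c + 1))"
    "bottom_row (c + 1) \<le> bottom_row c" "bottom_row c \<le> Suc (bottom_row (c + 1))"
proof -
  have c: "low \<le> c" "c \<le> high" "low \<le> c + 1" "c + 1 \<le> high" using assms by auto
  note eq = rows_on_eq[OF c(1,2)] rows_on_eq[OF c(3,4)]
  note mem = top_row_mem[OF c(1,2)] bottom_row_mem[OF c(1,2)] top_row_mem[OF c(3,4)] bottom_row_mem[OF c(3,4)]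
  \<comment> \<open>Connectedness supplies adjacent squares on the two diagonals; each contradiction
    below spans a region between one of them and an end.\<close>
  obtain i i' where i: "i \<in> rows_on c" "i' \<in> rows_on (c + 1)" "i' = i \<or> i = Suc i'"
    using contents_crossing[OF assms] by metis
  then have le: "top_row c \<le> i" "i \<le> bottom_row c" "top_row (c + 1) \<le> i'" "i' \<le> bottom_row (c + 1)"
    using eq by auto
  show "top_row (c + 1) \<le> top_row c"
  proof (rule ccontr)
    assume neg: "\<not> top_row (c + 1) \<le> top_row c"
    then have "top_row c \<in> rows_on (c + 1)"
      using le i(3) by (intro rows_on_convex[OF mem(1) i(2)]) auto
    then show False using neg eq(2) by auto
  qed
  show "top_row c \<le> Suc (top_row (c + 1))"
  proof (rule ccontr)
    assume neg: "\<not> top_row c \<le> Suc (top_row (c + 1))"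
    then have "Suc (top_row (c + 1)) \<in> rows_on c"
      using le i(3) by (intro rows_on_convex[OF mem(3) i(1)]) auto
    then show False using neg eq(1) by auto
  qed
  show "bottom_row (c + 1) \<le> bottom_row c"
  proof (rule ccontr)
    assume neg: "\<not> bottom_row (c + 1) \<le> bottom_row c"
    then have "Suc (bottom_row c) \<in> rows_on c"
      using le i(3) by (intro rows_on_convex[OF i(1) mem(4)]) auto
    then show False using eq(1) by auto
  qed
  show "bottom_row c \<le> Suc (bottom_row (c + 1))"
  proof (rule ccontr)
    assume neg: "\<not> bottom_row c \<le> Suc (bottom_row (c + 1))"
    then have "Suc (bottom_row (c + 1)) \<in> rows_on (c + 1)"
      using le i(3) by (intro rows_on_convex[OF i(2) mem(2)]) auto
    then show False using eq(2) by auto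
  qed
qed

text \<open>With two squares on the lowest diagonal, the square below the upper one would lie
  between them, on a still lower diagonal.\<close>

lemma low_single: "bottom_row low = top_row low"
proof (rule ccontr)
  note low = order_refl[of low] low_le_high
  assume "bottom_row low \<noteq> top_row low"
  then have "Suc (top_row low) \<in> rows_on (low - 1)"
    using top_le_bottom[OF low]
    by (intro rows_on_convex[OF top_row_mem[OF low] bottom_row_mem[OF low]]) auto
  then show False using rows_on_outside[of "low - 1"] by auto
qed

lemma high_single: "bottom_row high = top_row high"
proof (rule ccontr)
  note high = low_le_high order_refl[of high]
  assume "bottom_row high \<noteq> top_row high"
  then have "top_row high \<in> rows_on (high + 1)"
    using top_le_bottom[OF high]
    by (intro rows_on_convex[OF top_row_mem[OF high] bottom_row_mem[OF high]]) auto
  then show False using rows_on_outside[of "high + 1"] by auto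
qed

section \<open>Reading the walk off the shape\<close>

definition width :: nat where "width = nat (high - low)"

lemma width_high: "low + int width = high"
  using low_le_high by (simp add: width_def)

text \<open>Testing for a change suffices, since by \<open>row_steps\<close> an end can only stay or
  move up by one row.\<close>

definition boundary_walk :: "(bool \<times> bool) list" where
  "boundary_walk = map (\<lambda>t. (top_row (low + int t + 1) \<noteq> top_row (low + int t),
     bottom_row (low + int t + 1) \<noteq> bottom_row (low + int t))) [0..<width]"

lemma length_boundary_walk [simp]: "length boundary_walk = width"
  by (simp add: boundary_walk_def)

text \<open>Both ends are measured from \<open>top_row low\<close>, where they coincide by
  \<open>low_single\<close>.\<close>

lemma count_boundary_walk:
  "t \<le> width \<Longrightarrow> count_upto fst boundary_walk t + top_row (low + int t) = top_row low \<and>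
     count_upto snd boundary_walk t + bottom_row (low + int t) = top_row low"
proof (induction t)
  case 0
  then show ?case by (simp add: low_single)
next
  case (Suc t)
  then have t: "t < width" "low \<le> low + int t" "low + int t < high"
    by (auto simp: width_def)
  have nth: "boundary_walk ! t = (top_row (low + int t + 1) \<noteq> top_row (low + int t),
     bottom_row (low + int t + 1) \<noteq> bottom_row (low + int t))"
    using t(1) by (simp add: boundary_walk_def)
  have Suc_t: "low + int (Suc t) = low + int t + 1" by simp
  have "count_upto fst boundary_walk (Suc t) + top_row (low + int t + 1) =
      count_upto fst boundary_walk t + top_row (low + int t)"
    using row_steps(1,2)[OF t(2,3)] t(1)
    by (cases "top_row (low + int t + 1) = top_row (low + int t)") (simp_all add: count_upto_Suc nth)
  moreover have "count_upto snd boundary_walk (Suc t) + bottom_row (low + int t + 1) =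
      count_upto snd boundary_walk t + bottom_row (low + int t)"
    using row_steps(3,4)[OF t(2,3)] t(1)
    by (cases "bottom_row (low + int t + 1) = bottom_row (low + int t)")
      (simp_all add: count_upto_Suc nth)
  ultimately show ?case
    using Suc t(1) unfolding Suc_t by linarith
qed

lemma length_fst_boundary_walk:
  "length (filter fst boundary_walk) + top_row high = top_row low"
  using count_boundary_walk[of width] count_upto_length[of fst boundary_walk] by (simp add: width_high)

lemma walk_boundary_walk:
  assumes "\<And>k. card (diagonal A k) \<le> m"
  shows "walk m 1 boundary_walk"
  unfolding walk_iff
proof (intro conjI allI impI)
  fix t assume "t \<le> length boundary_walk"
  then have t: "t \<le> width" "low \<le> low + int t" "low + int t \<le> high"
    using width_high by auto
  note cnt = count_boundary_walk[OF t(1)] and le = top_le_bottom[OF t(2,3)]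
  show "count_upto snd boundary_walk t < 1 + count_upto fst boundary_walk t"
    using cnt le by linarith
  \<comment> \<open>The height is the size of the diagonal, bounded by hypothesis; the sign passes
    from content to the index of \<open>diagonal\<close>.\<close>
  have "card (rows_on (low + int t)) \<le> card (diagonal A (- (low + int t)))"
  proof (rule surj_card_le)
    show "finite (diagonal A (- (low + int t)))"
      by (rule finite_subset[OF _ fin]) (auto simp: diagonal_def)
    show "rows_on (low + int t) \<subseteq> fst ` diagonal A (- (low + int t))"
    proof
      fix i assume "i \<in> rows_on (low + int t)"
      then obtain j where "(i, j) \<in> A" "int j - int i = low + int t"
        by (auto simp: rows_on_def)
      then have "(i, j) \<in> diagonal A (- (low + int t))"
        by (simp add: diagonal_def)
      then show "i \<in> fst ` diagonal A (- (low + int t))" by force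
    qed
  qed
  also have "\<dots> \<le> m" by (rule assms)
  finally have "bottom_row (low + int t) < m + top_row (low + int t)"
    using le by (simp add: rows_on_eq[OF t(2,3)])
  then show "1 + count_upto fst boundary_walk t \<le> m + count_upto snd boundary_walk t"
    using cnt by linarith
next
  show "1 + count_upto fst boundary_walk (length boundary_walk) =
      Suc (count_upto snd boundary_walk (length boundary_walk))"
    using count_boundary_walk[of width] high_single by (simp add: width_high)
qed

lemma translate_of_walk_shape: "translate_of (walk_shape boundary_walk) A"
proof -
  let ?w = boundary_walk and ?r = "length (filter fst boundary_walk)"
  \<comment> \<open>Row 0 goes to the topmost row \<open>top_row high\<close>, and column 0 to that
    of the lowest diagonal's only square, in row \<open>top_row low\<close> with content
    \<open>low\<close>.\<close>
  let ?f = "\<lambda>(i, j). (int i + int (top_row high), int j + (int (top_row low) + low))"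
  have fwd: "?f s \<in> map_prod int int ` A" if "s \<in> walk_shape ?w" for s
  proof -
    obtain i j t where s: "s = (i, j)" and t: "t \<le> width" "?r \<le> i + count_upto fst ?w t"
      "i + count_upto snd ?w t \<le> ?r" "j + ?r = i + t"
      using \<open>s \<in> walk_shape ?w\<close> by (auto simp: walk_shape_def)
    have c: "low \<le> low + int t" "low + int t \<le> high" using t(1) width_high by auto
    have "i + top_row high \<in> rows_on (low + int t)"
      unfolding rows_on_eq[OF c]
      using count_boundary_walk[OF t(1)] length_fst_boundary_walk t(2,3) by auto
    then obtain j' where "(i + top_row high, j') \<in> A" "int j' = int (i + top_row high) + (low + int t)"
      by (auto simp: rows_on_def algebra_simps)
    then show ?thesis
      using t(4) length_fst_boundary_walk
      by (intro image_eqI[of _ _ "(i + top_row high, j')"]) (auto simp: s)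
  qed
  have bwd: "\<exists>s\<in>walk_shape ?w. ?f s = (int i', int j')" if "(i', j') \<in> A" for i' j'
  proof -
    have mem: "i' \<in> rows_on (int j' - int i')" using that by (simp add: mem_iff)
    then have c: "low \<le> int j' - int i'" "int j' - int i' \<le> high"
      using rows_on_outside[of "int j' - int i'"] by blast+
    define t where "t = nat (int j' - int i' - low)"
    have ct: "int j' - int i' = low + int t" "t \<le> width" using c by (auto simp: t_def width_def)
    note cnt = count_boundary_walk[OF ct(2)]
    have i': "top_row (low + int t) \<le> i'" "i' \<le> bottom_row (low + int t)"
      using mem rows_on_eq[OF c] unfolding ct(1) by auto
    have "count_upto fst ?w t \<le> ?r"
      using count_upto_mono(1)[of t width fst ?w] ct(2) count_upto_length[of fst ?w] by simp
    then have hi: "top_row high \<le> i'"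
      using cnt i'(1) length_fst_boundary_walk by linarith
    have rt: "?r \<le> (i' - top_row high) + t"
      using cnt i'(1) length_fst_boundary_walk hi count_upto_le[of fst ?w t] by linarith
    let ?s = "(i' - top_row high, (i' - top_row high) + t - ?r)"
    have "?s \<in> walk_shape ?w"
      using rt cnt i' ct(2) hi length_fst_boundary_walk
      by (subst walk_shape_iff[of _ t]) auto
    moreover have "?f ?s = (int i', int j')"
      using rt hi ct(1) length_fst_boundary_walk by (auto simp: of_nat_diff)
    ultimately show ?thesis by blast
  qed
  have "?f ` walk_shape ?w = map_prod int int ` A"
  proof
    show "?f ` walk_shape ?w \<subseteq> map_prod int int ` A"
      using fwd by blast
    show "map_prod int int ` A \<subseteq> ?f ` walk_shape ?w"
    proof
      fix p assume "p \<in> map_prod int int ` A"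
      then obtain i' j' where "p = (int i', int j')" "(i', j') \<in> A" by auto
      with bwd[of i' j'] show "p \<in> ?f ` walk_shape ?w" by (metis image_eqI)
    qed
  qed
  then show ?thesis unfolding translate_of_def by blast
qed

end

section \<open>The bijection between walks and classes of shapes, and its weights\<close>

lemma bij_betw_walk_CS_le:
  "bij_betw (\<lambda>w. translation `` {walk_shape w}) {w. walk m 1 w} (CS_le m)"
proof (rule bij_betw_imageI)
  show "inj_on (\<lambda>w. translation `` {walk_shape w}) {w. walk m 1 w}"
  proof (rule inj_onI)
    fix w w' assume "w \<in> {w. walk m 1 w}" "w' \<in> {w. walk m 1 w}"
      and eq: "translation `` {walk_shape w} = translation `` {walk_shape w'}"
    then have w: "walk m 1 w" "walk m 1 w'" by simp_all
    from eq have "(walk_shape w, walk_shape w') \<in> translation"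
      by (subst (asm) eq_equiv_class_iff[OF equiv_translation]) (use w skew_shape_walk_shape in auto)
    with w show "w = w'"
      by (auto simp: translation_def intro: walk_shape_translate_inj)
  qed
  show "(\<lambda>w. translation `` {walk_shape w}) ` {w. walk m 1 w} = CS_le m"
  proof
    show "(\<lambda>w. translation `` {walk_shape w}) ` {w. walk m 1 w} \<subseteq> CS_le m"
    proof clarify
      fix w assume w: "walk m 1 w"
      show "translation `` {walk_shape w} \<in> CS_le m"
        unfolding CS_le_def
        using skew_shape_walk_shape[OF w] walk_shape_corners(1)[OF w] connected_walk_shape[OF w]
          diagonal_walk_shape[OF w] by (blast intro: quotientI)
    qed
  next
    show "CS_le m \<subseteq> (\<lambda>w. translation `` {walk_shape w}) ` {w. walk m 1 w}"
    proof
      fix \<alpha> assume "\<alpha> \<in> CS_le m"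
      then obtain A where A: "skew_shape A" "A \<noteq> {}" "connected_shape A"
        "\<And>k. card (diagonal A k) \<le> m" "\<alpha> = translation `` {A}"
        by (elim rep_CS_le) blast
      interpret connected_skew A
        by standard (use A in \<open>auto simp: skew_shape_iff_order_convex\<close>)
      have w: "walk m 1 boundary_walk"
        by (rule walk_boundary_walk) (rule A(4))
      have "(walk_shape boundary_walk, A) \<in> translation"
        using skew_shape_walk_shape[OF w] A(1) translate_of_walk_shape
        by (simp add: translation_def)
      then have "\<alpha> = translation `` {walk_shape boundary_walk}"
        unfolding A(5) by (rule equiv_class_eq[OF equiv_translation, symmetric])
      with w show "\<alpha> \<in> (\<lambda>w. translation `` {walk_shape w}) ` {w. walk m 1 w}"
        by blast
    qed
  qed
qed

text \<open>The extra factor is the row and the column of the starting square, which no step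
  accounts for.\<close>

lemma CS_weight_walk_shape:
  assumes "walk m 1 w"
  shows "CS_weight (translation `` {walk_shape w}) = qnu * (qnu * zv ^ 2) * walk_weight 1 w"
proof -
  have "translation `` {walk_shape w} \<in> CS_le m"
    using bij_betw_walk_CS_le[of m] assms by (auto simp: bij_betw_def)
  moreover have "walk_shape w \<in> translation `` {walk_shape w}"
    using skew_shape_walk_shape[OF assms] by (simp add: translation_def translate_of_refl)
  ultimately have "CS_weight (translation `` {walk_shape w}) =
      (qnu * zv ^ 2) ^ col_shape (walk_shape w) * qnu ^ row_shape (walk_shape w) *
      qv ^ area_shape (walk_shape w)"
    unfolding CS_weight_def by (simp only: stats_class)
  then show ?thesis
    unfolding col_walk_shape[OF assms] row_walk_shape[OF assms] area_walk_shape[OF assms]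
      walk_weight_monomial power_Suc
    by (simp only: mult_ac)
qed

lemma formal_sum_CS_weight:
  "formal_sum CS_weight (CS_le m) = qnu * (qnu * zv ^ 2) * walk_gf m 1"
proof -
  have "formal_sum CS_weight (CS_le m) =
      formal_sum (\<lambda>w. qnu * (qnu * zv ^ 2) * walk_weight 1 w) {w. walk m 1 w}"
    by (rule formal_sum_reindex[OF bij_betw_walk_CS_le]) (simp only: mem_Collect_eq CS_weight_walk_shape)
  then show ?thesis
    by (simp only: formal_sum_walk_mult)
qed

section \<open>The generating function of the shapes\<close>

theorem theorem1p9:
  fixes m :: nat
  assumes "m \<ge> 1"
  shows "emb (formal_sum CS_weight (CS_le m)) = - emb qnu * emb zv * (R (m - 1) 2 / R m 1)"
proof -
  define x z q where "x = emb qnu" "z = emb zv" "q = emb qv"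
  have nz: "x \<noteq> 0" "z \<noteq> 0" "q \<noteq> 0"
    by (simp_all add: x_z_q_def emb_eq_0_iff qnu_def zv_def qv_def)
  \<comment> \<open>\<open>P k\<close> stands for p to the power nu + k, with p the inverse of
    q.\<close>
  define P where "P k = inverse (x * q ^ k)" for k
  define c where "c k = z + inverse z * (1 - P k)" for k
  \<comment> \<open>\<open>D k\<close> has index \<open>m + 1 - k\<close> and order nu + k. Index -1
    is treated apart because the truncated subtraction would give index 0 and value 1.\<close>
  define D where "D k = (if k = Suc (Suc m) then 0 else lommel (Suc m - k) z (P k) (inverse q))" for k
  define G where "G k = emb (walk_gf m k)" for k
  have P_Suc: "P k * inverse q = P (Suc k)" for k
    using nz by (simp add: P_def field_simps)
  have P_Suc_Suc: "P k * inverse q ^ 2 = P (Suc (Suc k))" for k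
    using P_Suc[of k] P_Suc[of "Suc k"] by (simp add: power2_eq_square flip: mult.assoc)
  have D_rec: "D k = c k * D (Suc k) - D (Suc (Suc k))" if k: "1 \<le> k" "k \<le> m" for k
  proof (cases "k = m")
    case True
    then show ?thesis by (simp add: D_def c_def)
  next
    case False
    then obtain n where n: "m = Suc (k + n)"
      using k less_iff_Suc_add[of k m] by auto
    show ?thesis
      using lommel_Suc_Suc_shift[of n z "P k" "inverse q"]
      by (simp add: n D_def c_def P_Suc P_Suc_Suc Suc_diff_le del: lommel.simps)
  qed
  have G_rec: "- c k * G k = inverse z * G (Suc k) + z * G (k - 1) +
      (if k = 1 then inverse (x * z) else 0)" if "1 \<le> k" "k \<le> m" for k
  proof -
    have "G k = q ^ k * (of_bool (k = 1) + x * (1 + z ^ 2) * G k + x * G (Suc k) +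
        x * z ^ 2 * G (k - 1))"
      unfolding G_def
      by (subst walk_gf_rec[OF that])
        (simp add: emb_add emb_mult emb_power emb_0 emb_1 x_z_q_def of_bool_def)
    \<comment> \<open>This factor cancels \<open>q ^ k\<close> and \<open>x\<close> and leaves
      coefficients \<open>inverse z\<close> and \<open>z\<close> on the two neighbours; the term
      \<open>P k * inverse z * G k\<close> then completes \<open>- c k\<close>.\<close>
    then have "P k * inverse z * G k = P k * inverse z * (q ^ k * (of_bool (k = 1) +
        x * (1 + z ^ 2) * G k + x * G (Suc k) + x * z ^ 2 * G (k - 1)))"
      by (rule arg_cong)
    also have "\<dots> = inverse z * (1 + z ^ 2) * G k + inverse z * G (Suc k) + z * G (k - 1) +
        of_bool (k = 1) * inverse (x * z)"
      using nz by (simp add: P_def field_simps power2_eq_square)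
    also have "inverse z * (1 + z ^ 2) = inverse z + z"
      using nz by (simp add: field_simps power2_eq_square)
    finally show ?thesis
      by (simp add: c_def algebra_simps of_bool_def)
  qed
  have "x * (x * z ^ 2) * G 1 = - x * z * (D 2 / D 1)"
  proof (rule tridiagonal_system_first[where c = c and m = m])
    \<comment> \<open>The boundary values vanish because no walk has height 0 or
      \<open>m + 1\<close>.\<close>
    show "G 0 = 0" "G (Suc m) = 0"
      by (simp_all add: G_def walk_gf_outside emb_0)
  qed (use nz assms D_rec G_rec in \<open>auto simp: D_def\<close>)
  moreover have "D 1 = R m 1" "D 2 = R (m - 1) 2"
    using assms by (simp_all add: D_def P_def R_def x_z_q_def)
  ultimately show ?thesis
    by (simp add: formal_sum_CS_weight emb_mult emb_power G_def x_z_q_def)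
qed

end
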